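(* Let $H=H_{\tau}$, $\tau$ real, be an analytic one-parameter family of $n\times n$ hermitian matrices with eigenvalues $\lambda_j=\lambda_j(\tau)$, $j=1,\dots,n$. Let $F$ be a twice differentiable function defined on an interval containing the spectra of $H_{\tau}$ and let $f=F'$ be the derivative function of $F$. (1) Suppose that $F$ is convex (respectively concave). Then $$\frac{d^2}{d\tau^2}\mathrm{Tr}(F(H))\geq(\text{resp. }\leq)\ \mathrm{Tr}(f(H)\ddot{H})+\sum_{j=1}^nf'(\lambda_j)\dot{\lambda}_j^2,$$ with equality if $F$ is an affine linear function. In particular, if $\ddot{H}=0$ then $\mathrm{Tr}(F(H))$ is convex (resp. concave) in $\tau$. (2) Suppose that $f'=F''$ is convex (respectively concave). Then $$\frac{d^2}{d\tau^2}\mathrm{Tr}(F(H))\leq(\text{resp. }\geq)\ \mathrm{Tr}(f(H)\ddot{H})+\mathrm{Tr}(\dot{H}f'(H)\dot{H}).$$ Equality holds iff $F$ is a polynomial of degree $3$. (3) Suppose that $F$ is of class $C^4$ and that $F''''=f'''$ is convex (respectively concave). Then $$\frac{d^2}{d\tau^2}\mathrm{Tr}(F(H))\geq(\text{resp. }\leq)\ \mathrm{Tr}(f(H)\ddot{H})+\mathrm{Tr}(\dot{H}f'(H)\dot{H})+\frac{1}{12}\mathrm{Tr}\big(f'''(H)[H,\dot{H}]^2\big).$$ Equality holds iff $F$ is a polynomial of degree $5$.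
   Context: A dot denotes $d/d\tau$; $[X,Y]=XY-YX$; $\mathrm{Tr}$ is the matrix trace; $g(H)$ for a real function $g$ is defined by functional calculus of the hermitian matrix $H$. The eigenvalues $\lambda_j(\tau)$, with orthonormal eigenvectors, are taken to be analytic in $\tau$.
   Formalization: "Equality holds iff" is read as equality for all analytic families with spectra in the interval, "degree 3 (5)" as degree at most 3 (5), and the "only if" direction needs n ≥ 2; for a single family (e.g. H constant, F = exp) or n = 1 the literal claim is false. *)

theory Defs
  imports "HOL-Analysis.Analysis" "HOL-Computational_Algebra.Polynomial"
begin

definition real_analytic_on :: "(real \<Rightarrow> 'a::real_normed_vector) \<Rightarrow> real set \<Rightarrow> bool"
  where "real_analytic_on X T \<longleftrightarrow>
    (\<forall>t\<in>T. \<exists>a r. r > 0 \<and> (\<forall>s. \<bar>s - t\<bar> < r \<longrightarrow> (\<lambda>k. (s - t) ^ k *\<^sub>R a k) sums X s))"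

abbreviation dot :: "(real \<Rightarrow> 'a::real_normed_vector) \<Rightarrow> real \<Rightarrow> 'a"
  where "dot X \<equiv> (\<lambda>\<tau>. vector_derivative X (at \<tau>))"

definition cadjoint :: "complex^'n^'m \<Rightarrow> complex^'m^'n"
  where "cadjoint A = (\<chi> i j. cnj (A $ j $ i))"

definition hermitian :: "complex^'n^'n \<Rightarrow> bool"
  where "hermitian A \<longleftrightarrow> cadjoint A = A"

definition unitary :: "complex^'n^'n \<Rightarrow> bool"
  where "unitary U \<longleftrightarrow> cadjoint U ** U = mat 1 \<and> U ** cadjoint U = mat 1"

definition cinner :: "complex^'n \<Rightarrow> complex^'n \<Rightarrow> complex"
  where "cinner x y = (\<Sum>i\<in>UNIV. cnj (x $ i) * y $ i)"

definition rdiag :: "('n \<Rightarrow> real) \<Rightarrow> complex^'n^'n"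
  where "rdiag d = (\<chi> i j. if i = j then complex_of_real (d i) else 0)"

definition commutator :: "complex^'n^'n \<Rightarrow> complex^'n^'n \<Rightarrow> complex^'n^'n"
  where "commutator X Y = X ** Y - Y ** X"

text \<open>
  Functional calculus of a hermitian matrix: if \<open>A = U diag(d) U*\<close> with \<open>U\<close> unitary and \<open>d\<close> real,
  then \<open>g(A) = U diag(g(d)) U*\<close>. This does not depend on the diagonalization chosen
  (\<open>fun_calc_eq\<close> below). The value is unspecified if \<open>A\<close> is not hermitian.
\<close>

definition fun_calc :: "(real \<Rightarrow> real) \<Rightarrow> complex^'n^'n \<Rightarrow> complex^'n^'n"
  where "fun_calc g A = (THE B. \<exists>U d. unitary U \<and> A = U ** rdiag d ** cadjoint U \<and>
                                     B = U ** rdiag (\<lambda>i. g (d i)) ** cadjoint U)"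

lemma matrix_mult_rdiag: "(W ** rdiag d) $ i $ j = W $ i $ j * of_real (d j)"
proof -
  have "(W ** rdiag d) $ i $ j = (\<Sum>k\<in>UNIV. if k = j then W $ i $ k * of_real (d k) else 0)"
    unfolding matrix_matrix_mult_def rdiag_def vec_lambda_beta by (rule sum.cong) simp_all
  then show ?thesis by simp
qed

lemma rdiag_matrix_mult: "(rdiag d ** W) $ i $ j = of_real (d i) * W $ i $ j"
proof -
  have "(rdiag d ** W) $ i $ j = (\<Sum>k\<in>UNIV. if k = i then of_real (d k) * W $ k $ j else 0)"
    unfolding matrix_matrix_mult_def rdiag_def vec_lambda_beta by (rule sum.cong) simp_all
  then show ?thesis by simp
qed

lemma fun_calc_unique:
  fixes U V :: "complex^'n^'n"
  assumes U: "unitary U" and V: "unitary V"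
    and eq: "U ** rdiag d ** cadjoint U = V ** rdiag e ** cadjoint V"
  shows "U ** rdiag (\<lambda>i. g (d i)) ** cadjoint U = V ** rdiag (\<lambda>i. g (e i)) ** cadjoint V"
proof -
  have u: "cadjoint U ** U = mat 1" "U ** cadjoint U = mat 1"
    and v: "cadjoint V ** V = mat 1" "V ** cadjoint V = mat 1"
    using U V by (auto simp: unitary_def)
  define W where "W = cadjoint V ** U"
  have "W ** rdiag d = cadjoint V ** (U ** rdiag d ** cadjoint U) ** U"
    by (simp only: W_def matrix_mul_assoc[symmetric] u matrix_mul_rid)
  also have "\<dots> = (cadjoint V ** V) ** rdiag e ** W"
    by (simp only: eq W_def matrix_mul_assoc)
  finally have *: "W ** rdiag d = rdiag e ** W" by (simp only: v matrix_mul_lid)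
  have "W ** rdiag (\<lambda>i. g (d i)) = rdiag (\<lambda>i. g (e i)) ** W"
  proof -
    have "W $ i $ j * of_real (g (d j)) = of_real (g (e i)) * W $ i $ j" for i j
    proof -
      have "W $ i $ j * of_real (d j) = of_real (e i) * W $ i $ j"
        using arg_cong[OF *, of "\<lambda>M. M $ i $ j"] by (simp add: matrix_mult_rdiag rdiag_matrix_mult)
      then show ?thesis by (cases "W $ i $ j = 0") (auto simp: mult.commute)
    qed
    then show ?thesis by (simp add: vec_eq_iff matrix_mult_rdiag rdiag_matrix_mult)
  qed
  then have "V ** (W ** rdiag (\<lambda>i. g (d i))) ** cadjoint U =
      V ** (rdiag (\<lambda>i. g (e i)) ** W) ** cadjoint U" by (rule arg_cong[where f = "\<lambda>M. V ** M ** cadjoint U"])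
  moreover have "V ** (W ** M) ** cadjoint U = (V ** cadjoint V) ** U ** M ** cadjoint U" for M
    by (simp only: W_def matrix_mul_assoc)
  moreover have "V ** (M ** W) ** cadjoint U = V ** M ** cadjoint V ** (U ** cadjoint U)" for M
    by (simp only: W_def matrix_mul_assoc)
  ultimately show ?thesis by (simp only: u v matrix_mul_lid matrix_mul_rid)
qed

lemma fun_calc_eq:
  assumes "unitary U" and "A = U ** rdiag d ** cadjoint U"
  shows "fun_calc g A = U ** rdiag (\<lambda>i. g (d i)) ** cadjoint U"
  unfolding fun_calc_def
proof (rule the_equality)
  show "\<exists>V e. unitary V \<and> A = V ** rdiag e ** cadjoint V \<and>
      U ** rdiag (\<lambda>i. g (d i)) ** cadjoint U = V ** rdiag (\<lambda>i. g (e i)) ** cadjoint V"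
    using assms by blast
next
  fix B
  assume "\<exists>V e. unitary V \<and> A = V ** rdiag e ** cadjoint V \<and>
      B = V ** rdiag (\<lambda>i. g (e i)) ** cadjoint V"
  then obtain V e where V: "unitary V" and A: "A = V ** rdiag e ** cadjoint V"
    and B: "B = V ** rdiag (\<lambda>i. g (e i)) ** cadjoint V" by blast
  show "B = U ** rdiag (\<lambda>i. g (d i)) ** cadjoint U"
    unfolding B by (rule fun_calc_unique[OF V assms(1) trans[OF A[symmetric] assms(2)]])
qed

text \<open>
  An analytic family of hermitian matrices, together with analytic eigenvalues \<open>ev j\<close> (listed with
  multiplicity, hence indexed by \<open>'n\<close>) and analytic orthonormal eigenvectors \<open>v j\<close>, whose spectra
  are contained in \<open>I\<close>. The parameter ranges over \<open>T\<close>.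
\<close>

definition hermitian_family ::
  "real set \<Rightarrow> real set \<Rightarrow> (real \<Rightarrow> complex^'n^'n) \<Rightarrow> ('n \<Rightarrow> real \<Rightarrow> real) \<Rightarrow>
    ('n \<Rightarrow> real \<Rightarrow> complex^'n) \<Rightarrow> bool"
  where "hermitian_family T I H ev v \<longleftrightarrow>
    real_analytic_on H T \<and>
    (\<forall>j. real_analytic_on (ev j) T \<and> real_analytic_on (v j) T) \<and>
    (\<forall>\<tau>\<in>T. hermitian (H \<tau>) \<and>
      (\<forall>j k. cinner (v j \<tau>) (v k \<tau>) = (if j = k then 1 else 0)) \<and>
      (\<forall>j. H \<tau> *v v j \<tau> = complex_of_real (ev j \<tau>) *s v j \<tau> \<and> ev j \<tau> \<in> I))"

text \<open>
  All traces taken below are traces of hermitian matrices or of products of two hermitian matrices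
  (note that the square of a commutator of hermitian matrices is hermitian), so they are real and
  passing to the real part loses nothing.
\<close>

definition rtrace :: "complex^'n^'n \<Rightarrow> real"
  where "rtrace A = Re (trace A)"

lemma trace_mult_hermitian_real:
  assumes "hermitian A" and "hermitian B"
  shows "trace (A ** B) \<in> \<real>"
proof -
  have *: "cnj (A $ i $ k) = A $ k $ i" "cnj (B $ i $ k) = B $ k $ i" for i k
    using assms by (auto simp: cadjoint_def hermitian_def vec_eq_iff)
  have "cnj (trace (A ** B)) = (\<Sum>i\<in>UNIV. \<Sum>k\<in>UNIV. A $ k $ i * B $ i $ k)"
    by (simp add: trace_def matrix_matrix_mult_def *)
  also have "\<dots> = trace (A ** B)"
    unfolding trace_def matrix_matrix_mult_def by (subst sum.swap) simp
  finally show ?thesis by (simp add: complex_is_Real_iff complex_eq_iff)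
qed

abbreviation trace_fun :: "(real \<Rightarrow> real) \<Rightarrow> (real \<Rightarrow> complex^'n^'n) \<Rightarrow> real \<Rightarrow> real"
  where "trace_fun F H \<equiv> (\<lambda>\<tau>. rtrace (fun_calc F (H \<tau>)))"

abbreviation bound_1 ::
  "(real \<Rightarrow> real) \<Rightarrow> (real \<Rightarrow> real) \<Rightarrow> (real \<Rightarrow> complex^'n^'n) \<Rightarrow> ('n \<Rightarrow> real \<Rightarrow> real) \<Rightarrow> real \<Rightarrow> real"
  where "bound_1 f f' H ev \<tau> \<equiv>
    rtrace (fun_calc f (H \<tau>) ** dot (dot H) \<tau>) + (\<Sum>j\<in>UNIV. f' (ev j \<tau>) * (dot (ev j) \<tau>)\<^sup>2)"

abbreviation bound_2 ::
  "(real \<Rightarrow> real) \<Rightarrow> (real \<Rightarrow> real) \<Rightarrow> (real \<Rightarrow> complex^'n^'n) \<Rightarrow> real \<Rightarrow> real"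
  where "bound_2 f f' H \<tau> \<equiv>
    rtrace (fun_calc f (H \<tau>) ** dot (dot H) \<tau>) + rtrace (dot H \<tau> ** fun_calc f' (H \<tau>) ** dot H \<tau>)"

abbreviation bound_3 ::
  "(real \<Rightarrow> real) \<Rightarrow> (real \<Rightarrow> real) \<Rightarrow> (real \<Rightarrow> real) \<Rightarrow> (real \<Rightarrow> complex^'n^'n) \<Rightarrow> real \<Rightarrow> real"
  where "bound_3 f f' f''' H \<tau> \<equiv>
    rtrace (fun_calc f (H \<tau>) ** dot (dot H) \<tau>) + rtrace (dot H \<tau> ** fun_calc f' (H \<tau>) ** dot H \<tau>) +
    1 / 12 * rtrace (fun_calc f''' (H \<tau>) **
      (commutator (H \<tau>) (dot H \<tau>) ** commutator (H \<tau>) (dot H \<tau>)))"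

definition polynomial_on :: "real set \<Rightarrow> nat \<Rightarrow> (real \<Rightarrow> real) \<Rightarrow> bool"
  where "polynomial_on I d F \<longleftrightarrow> (\<exists>p. degree p \<le> d \<and> (\<forall>x\<in>I. F x = poly p x))"

end

(*
  Let l_j be the eigenvalues, v_j the eigenvectors and w_jk = |<v_j, v_k'>|^2, which is symmetric in
  j and k. Differentiating H v_k = l_k v_k gives <v_j, H' v_k> = (l_k - l_j) <v_j, v_k'> for distinct
  j and k. Together with second order perturbation theory and a symmetrization in j and k this yields

    D - bound_1 = sum_jk w_jk (f_j - f_k) (l_j - l_k),
    bound_2 - D = sum_jk w_jk [(l_j - l_k)^2 (f'_j + f'_k) / 2 - (f_j - f_k) (l_j - l_k)],
    D - bound_3 = sum_jk w_jk [(f_j - f_k) (l_j - l_k) - (l_j - l_k)^2 (f'_j + f'_k) / 2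
                               + (l_j - l_k)^4 (f'''_j + f'''_k) / 24],

  where D is the second derivative of the trace and f_j = f(l_j). The brackets have a sign because f is
  monotone, by the trapezoid rule for convex f', and by the corrected trapezoid rule for convex f'''.
  For the converse statements, two eigenvectors rotating in a plane with constant eigenvalues a and b
  isolate a single bracket, and its vanishing for all a and b forces f' (respectively f''') to be affine.
*)

theory Submission
  imports Defs
begin

section \<open>Real analytic functions\<close>

text \<open>Eigenvalues may cross, and there the classical second order formula, with its
  denominators l_j - l_k, breaks down. Measuring the motion of the eigenvectors by w_jk, instead of
  the entries of H', clears the denominators, and every bracket vanishes when l_j = l_k. Eigenvalues
  may also reach an endpoint of I, so F and its derivatives are differentiated within I. To work
  with derivatives that are merely known to exist, the quadrature rules are obtained from the
  monotonicity of explicit auxiliary functions and not from integrals. The constant 1/12 is the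
  integral over [0, 1] of the kernel x (1 - x) / 2 of the trapezoid rule.\<close>

lemma real_analytic_on_bounded_linear:
  assumes "bounded_linear h" and "real_analytic_on X T"
  shows "real_analytic_on (\<lambda>s. h (X s)) T"
  unfolding real_analytic_on_def
proof
  fix t assume "t \<in> T"
  then obtain a r where r: "r > 0" and s: "\<And>s. \<bar>s - t\<bar> < r \<Longrightarrow> (\<lambda>k. (s - t) ^ k *\<^sub>R a k) sums X s"
    using assms(2) unfolding real_analytic_on_def by blast
  have "(\<lambda>k. (s - t) ^ k *\<^sub>R h (a k)) sums h (X s)" if "\<bar>s - t\<bar> < r" for s
    using bounded_linear.sums[OF assms(1) s[OF that]]
    by (simp add: linear_simps(5)[OF assms(1)])
  with r show "\<exists>a r. r > 0 \<and> (\<forall>s. \<bar>s - t\<bar> < r \<longrightarrow> (\<lambda>k. (s - t) ^ k *\<^sub>R a k) sums h (X s))"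
    by (intro exI[of _ "\<lambda>k. h (a k)"] exI[of _ r]) simp
qed

lemma real_analytic_on_add:
  assumes "real_analytic_on X T" and "real_analytic_on Y T"
  shows "real_analytic_on (\<lambda>s. X s + Y s) T"
  unfolding real_analytic_on_def
proof
  fix t assume t: "t \<in> T"
  then obtain a r where r: "r > 0" and s: "\<And>s. \<bar>s - t\<bar> < r \<Longrightarrow> (\<lambda>k. (s - t) ^ k *\<^sub>R a k) sums X s"
    using assms(1) unfolding real_analytic_on_def by blast
  from t obtain b q where q: "q > 0" and u: "\<And>s. \<bar>s - t\<bar> < q \<Longrightarrow> (\<lambda>k. (s - t) ^ k *\<^sub>R b k) sums Y s"
    using assms(2) unfolding real_analytic_on_def by blast
  have "(\<lambda>k. (s - t) ^ k *\<^sub>R (a k + b k)) sums (X s + Y s)" if "\<bar>s - t\<bar> < min r q" for s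
    using sums_add[OF s u, of s s] that by (simp add: scaleR_add_right)
  moreover have "min r q > 0" using r q by simp
  ultimately show "\<exists>a r. r > 0 \<and> (\<forall>s. \<bar>s - t\<bar> < r \<longrightarrow> (\<lambda>k. (s - t) ^ k *\<^sub>R a k) sums (X s + Y s))"
    by (intro exI[of _ "\<lambda>k. a k + b k"] exI[of _ "min r q"]) simp
qed

lemma real_analytic_on_const: "real_analytic_on (\<lambda>s. c) T"
  unfolding real_analytic_on_def
proof
  fix t assume "t \<in> T"
  have "(\<lambda>k. (s - t) ^ k *\<^sub>R (if k = 0 then c else 0)) sums c" for s
    using sums_If_finite_set[of "{0}" "\<lambda>k. (s - t) ^ k *\<^sub>R c"]
    by (simp add: if_distrib[of "scaleR _"] cong: if_cong)
  then show "\<exists>a r. r > 0 \<and> (\<forall>s. \<bar>s - t\<bar> < r \<longrightarrow> (\<lambda>k. (s - t) ^ k *\<^sub>R a k) sums c)"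
    by (intro exI[of _ "\<lambda>k. if k = 0 then c else 0"] exI[of _ 1]) simp
qed

lemma real_analytic_on_sum:
  assumes "\<And>i. i \<in> A \<Longrightarrow> real_analytic_on (X i) T"
  shows "real_analytic_on (\<lambda>s. \<Sum>i\<in>A. X i s) T"
  using assms
  by (induction A rule: infinite_finite_induct)
     (auto intro: real_analytic_on_add real_analytic_on_const)

text \<open>The addition formulas move the centre of expansion: around \<open>t\<close> the function
  is a fixed combination of the cosine and sine series in \<open>c * (s - t)\<close>. These converge
  everywhere, hence the radius 1. The factor \<open>c\<close> accommodates the double angle in the
  rotating families.\<close>

lemma real_analytic_on_cos: "real_analytic_on (\<lambda>s. cos (c * s)) T"
  and real_analytic_on_sin: "real_analytic_on (\<lambda>s. sin (c * s)) T"
proof -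
  have co: "(\<lambda>k. (s - t) ^ k *\<^sub>R (c ^ k * cos_coeff k)) sums cos (c * (s - t))" for s t
    using cos_converges[of "c * (s - t)"] by (simp add: power_mult_distrib mult_ac)
  have si: "(\<lambda>k. (s - t) ^ k *\<^sub>R (c ^ k * sin_coeff k)) sums sin (c * (s - t))" for s t
    using sin_converges[of "c * (s - t)"] by (simp add: power_mult_distrib mult_ac)
  have eq: "c * s = c * t + c * (s - t)" for s t by (simp add: algebra_simps)
  have "(\<lambda>k. (s - t) ^ k *\<^sub>R (cos (c * t) * (c ^ k * cos_coeff k) - sin (c * t) * (c ^ k * sin_coeff k)))
      sums cos (c * s)" for s t
    using sums_diff[OF sums_mult[OF co, of "cos (c * t)"] sums_mult[OF si, of "sin (c * t)"], of s t s t]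
    unfolding eq[of s t] cos_add by (simp add: algebra_simps)
  then show "real_analytic_on (\<lambda>s. cos (c * s)) T"
    unfolding real_analytic_on_def by (intro ballI exI[of _ 1] exI conjI allI impI zero_less_one)
  have "(\<lambda>k. (s - t) ^ k *\<^sub>R (sin (c * t) * (c ^ k * cos_coeff k) + cos (c * t) * (c ^ k * sin_coeff k)))
      sums sin (c * s)" for s t
    using sums_add[OF sums_mult[OF co, of "sin (c * t)"] sums_mult[OF si, of "cos (c * t)"], of s t s t]
    unfolding eq[of s t] sin_add by (simp add: algebra_simps)
  then show "real_analytic_on (\<lambda>s. sin (c * s)) T"
    unfolding real_analytic_on_def by (intro ballI exI[of _ 1] exI conjI allI impI zero_less_one)
qed

text \<open>The series at \<open>t\<close> has to represent \<open>Y\<close> on a full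
  neighbourhood, so its radius is shrunk until that neighbourhood lies inside the open set
  \<open>T\<close>.\<close>

lemma real_analytic_on_cong:
  assumes "real_analytic_on X T" and "open T" and eq: "\<And>s. s \<in> T \<Longrightarrow> X s = Y s"
  shows "real_analytic_on Y T"
  unfolding real_analytic_on_def
proof
  fix t assume t: "t \<in> T"
  then obtain a r where r: "r > 0" and s: "\<And>s. \<bar>s - t\<bar> < r \<Longrightarrow> (\<lambda>k. (s - t) ^ k *\<^sub>R a k) sums X s"
    using assms(1) unfolding real_analytic_on_def by blast
  obtain e where e: "e > 0" "\<And>s. \<bar>s - t\<bar> < e \<Longrightarrow> s \<in> T"
    using \<open>open T\<close> t unfolding open_dist dist_real_def by blast
  have "(\<lambda>k. (s - t) ^ k *\<^sub>R a k) sums Y s" if "\<bar>s - t\<bar> < min r e" for s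
    using s[of s] eq[of s] e(2)[of s] that by simp
  moreover have "min r e > 0" using r e by simp
  ultimately show "\<exists>a r. r > 0 \<and> (\<forall>s. \<bar>s - t\<bar> < r \<longrightarrow> (\<lambda>k. (s - t) ^ k *\<^sub>R a k) sums Y s)"
    by blast
qed

text \<open>Termwise differentiation. The local claim covers every \<open>s\<close> within the
  radius, also outside \<open>T\<close>, because the differentiated series must represent
  \<open>dot X\<close> on that whole neighbourhood.\<close>

lemma real_analytic_on_real_deriv:
  fixes X :: "real \<Rightarrow> real"
  assumes "real_analytic_on X T"
  shows "t \<in> T \<Longrightarrow> (X has_vector_derivative dot X t) (at t)"
    and "real_analytic_on (dot X) T"
proof -
  have *: "\<exists>a r. r > 0 \<and> (\<forall>s. \<bar>s - t\<bar> < r \<longrightarrow> (X has_vector_derivative dot X s) (at s) \<and>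
      (\<lambda>k. (s - t) ^ k *\<^sub>R a k) sums dot X s)" if t: "t \<in> T" for t
  proof -
    from t assms obtain a r where r: "r > 0"
      and "\<And>s. \<bar>s - t\<bar> < r \<Longrightarrow> (\<lambda>k. (s - t) ^ k *\<^sub>R a k) sums X s"
      unfolding real_analytic_on_def by blast
    then have s: "\<And>s. \<bar>s - t\<bar> < r \<Longrightarrow> (\<lambda>k. a k * (s - t) ^ k) sums X s"
      by (simp add: mult.commute)
    have sm: "summable (\<lambda>k. a k * z ^ k)" if "norm z < r" for z
      using s[of "t + z"] that by (auto simp: sums_iff)
    define D where "D s = (\<Sum>k. diffs a k * (s - t) ^ k)" for s
    have "(X has_vector_derivative D s) (at s)" if "\<bar>s - t\<bar> < r" for s
    proof -
      have "((\<lambda>z. \<Sum>k. a k * z ^ k) has_field_derivative D s) (at (s - t))"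
        unfolding D_def using termdiffs_strong'[OF sm, of r "s - t"] that by simp
      then have "((\<lambda>s. \<Sum>k. a k * (s - t) ^ k) has_field_derivative D s) (at s)"
        using DERIV_shift[of "\<lambda>z. \<Sum>k. a k * z ^ k" "D s" s "- t"] by simp
      then have "(X has_field_derivative D s) (at s)"
      proof (rule has_field_derivative_transform_within_open[where S = "{t - r <..< t + r}"])
        show "(\<Sum>k. a k * (x - t) ^ k) = X x" if "x \<in> {t - r<..<t + r}" for x
          using s[of x] that by (auto simp: sums_iff abs_if)
      qed (use that in auto)
      then show ?thesis by (simp add: has_real_derivative_iff_has_vector_derivative)
    qed
    moreover from this have "D s = dot X s" if "\<bar>s - t\<bar> < r" for s
      using that by (metis vector_derivative_at)
    moreover have "(\<lambda>k. (s - t) ^ k *\<^sub>R diffs a k) sums D s" if "\<bar>s - t\<bar> < r" for s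
      unfolding D_def using termdiff_converges[OF _ sm, of "s - t" r] that
      by (simp add: mult.commute summable_sums)
    ultimately have "\<forall>s. \<bar>s - t\<bar> < r \<longrightarrow> (X has_vector_derivative dot X s) (at s) \<and>
        (\<lambda>k. (s - t) ^ k *\<^sub>R diffs a k) sums dot X s"
      by simp
    with r show ?thesis by blast
  qed
  show "(X has_vector_derivative dot X t) (at t)" if "t \<in> T"
    using *[OF that] by auto
  show "real_analytic_on (dot X) T"
    unfolding real_analytic_on_def using * by blast
qed

text \<open>Reduction to coordinates: each \<open>X s \<bullet> b\<close> is a real analytic scalar
  function, to which termwise differentiation applies.\<close>

lemma real_analytic_on_deriv:
  fixes X :: "real \<Rightarrow> 'a::euclidean_space"
  assumes X: "real_analytic_on X T" and "open T"
  shows "t \<in> T \<Longrightarrow> (X has_vector_derivative dot X t) (at t)"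
    and "real_analytic_on (dot X) T"
proof -
  define D where "D s = (\<Sum>b\<in>Basis. dot (\<lambda>s. X s \<bullet> b) s *\<^sub>R b)" for s
  have comp: "real_analytic_on (\<lambda>s. X s \<bullet> b) T" for b
    by (rule real_analytic_on_bounded_linear[OF bounded_linear_inner_left X])
  have "((\<lambda>s. \<Sum>b\<in>Basis. (X s \<bullet> b) *\<^sub>R b) has_vector_derivative D t) (at t)" if "t \<in> T" for t
    unfolding D_def
    by (intro has_vector_derivative_sum bounded_linear.has_vector_derivative[OF bounded_linear_scaleR_left]
        real_analytic_on_real_deriv(1)[OF comp that])
  then have D: "(X has_vector_derivative D t) (at t)" if "t \<in> T" for t
    using that by (simp add: euclidean_representation)
  then have eq: "D t = dot X t" if "t \<in> T" for t
    using that by (metis vector_derivative_at)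
  show "(X has_vector_derivative dot X t) (at t)" if "t \<in> T"
    using D eq that by metis
  have "real_analytic_on D T"
    unfolding D_def
    by (intro real_analytic_on_sum real_analytic_on_bounded_linear[OF bounded_linear_scaleR_left]
        real_analytic_on_real_deriv(2)[OF comp])
  then show "real_analytic_on (dot X) T"
    using \<open>open T\<close> eq by (rule real_analytic_on_cong)
qed

section \<open>Convex functions and quadrature rules\<close>

text \<open>On a one-point interval the filter is trivial and every number counts as a derivative. A
  second point excludes this, which uniqueness of derivatives and limits of difference quotients
  rely on.\<close>

lemma is_interval_imp_nontrivial_at:
  fixes I :: "real set"
  assumes "is_interval I" "x \<in> I" "y \<in> I" "x \<noteq> y"
  shows "at x within I \<noteq> bot"
proof -
  have "x islimpt I"
    using connected_imp_perfect[of I x] assms by (auto simp: is_interval_connected_1)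
  then show ?thesis by (simp add: trivial_limit_within)
qed

text \<open>Along the segment from \<open>x\<close> to \<open>y\<close> the quotient (F (x + t (y -
  x)) - F x) / t is at most F y - F x by convexity, and it tends to d (y - x) as t decreases to 0.
  Parametrizing by t treats both orders of \<open>x\<close> and \<open>y\<close> at once and stays
  inside \<open>I\<close>.\<close>

lemma convex_on_deriv_tangent:
  fixes F :: "real \<Rightarrow> real"
  assumes "convex_on I F" "x \<in> I" "y \<in> I" and F: "(F has_real_derivative d) (at x within I)"
  shows "F y - F x \<ge> d * (y - x)"
proof -
  let ?g = "\<lambda>t. x + t * (y - x)"
  have sub: "?g ` {0..1} \<subseteq> I"
  proof
    fix z assume "z \<in> ?g ` {0..1}"
    then obtain t where t: "0 \<le> t" "t \<le> 1" "z = x + t * (y - x)" by auto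
    have "(1 - t) *\<^sub>R x + t *\<^sub>R y \<in> I"
      using convexD[OF convex_on_imp_convex[OF assms(1)] assms(2,3), of "1 - t" t] t by simp
    moreover have "(1 - t) *\<^sub>R x + t *\<^sub>R y = z" using t by (simp add: algebra_simps)
    ultimately show "z \<in> I" by simp
  qed
  have "(F has_real_derivative d) (at (?g 0) within ?g ` {0..1})"
    using has_field_derivative_subset[OF F sub] by simp
  moreover have "(?g has_real_derivative (y - x)) (at 0 within {0..1})"
    by (auto intro!: derivative_eq_intros)
  ultimately have "(F \<circ> ?g has_real_derivative d * (y - x)) (at 0 within {0..1})"
    by (rule DERIV_image_chain)
  then have lim: "((\<lambda>t. (F (?g t) - F x) / t) \<longlongrightarrow> d * (y - x)) (at 0 within {0..1})"
    by (simp add: has_field_derivative_iff)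
  have "at (0::real) within {0..1} \<noteq> bot"
    by (rule is_interval_imp_nontrivial_at[of _ _ 1]) (auto simp: is_interval_cc)
  moreover have "eventually (\<lambda>t. (F (?g t) - F x) / t \<le> F y - F x) (at 0 within {0..1})"
  proof (unfold eventually_at_filter, rule always_eventually, safe)
    fix t :: real assume t: "t \<noteq> 0" "t \<in> {0..1}"
    have "F ((1 - t) *\<^sub>R x + t *\<^sub>R y) \<le> (1 - t) * F x + t * F y"
      using convex_onD[OF assms(1), of t x y] assms t by simp
    moreover have "(1 - t) *\<^sub>R x + t *\<^sub>R y = ?g t" by (simp add: algebra_simps)
    ultimately show "(F (?g t) - F x) / t \<le> F y - F x"
      using t by (simp add: field_simps)
  qed
  ultimately show ?thesis using lim by (intro tendsto_upperbound[of _ _ "at 0 within {0..1}"])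
qed

text \<open>In the sum of the tangent inequalities at \<open>x\<close> and at \<open>y\<close> the
  values of \<open>F\<close> cancel.\<close>

lemma convex_on_deriv_mono:
  fixes F f :: "real \<Rightarrow> real"
  assumes "convex_on I F" "x \<in> I" "y \<in> I"
    and F: "\<And>x. x \<in> I \<Longrightarrow> (F has_real_derivative f x) (at x within I)"
  shows "(f x - f y) * (x - y) \<ge> 0"
  using convex_on_deriv_tangent[OF assms(1-3) F[OF assms(2)]]
    convex_on_deriv_tangent[OF assms(1,3,2) F[OF assms(3)]]
  by (simp add: algebra_simps)

text \<open>Difference quotients of the increasing function \<open>f\<close> are nonnegative; the
  second point \<open>y\<close> makes their limit meaningful.\<close>

lemma convex_on_deriv2_nonneg:
  fixes F f :: "real \<Rightarrow> real"
  assumes "convex_on I F" "x \<in> I" "y \<in> I" "x \<noteq> y"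
    and F: "\<And>x. x \<in> I \<Longrightarrow> (F has_real_derivative f x) (at x within I)"
    and f: "(f has_real_derivative d) (at x within I)"
  shows "d \<ge> 0"
proof (rule tendsto_lowerbound)
  show "((\<lambda>z. (f z - f x) / (z - x)) \<longlongrightarrow> d) (at x within I)"
    using f by (simp add: has_field_derivative_iff)
  show "at x within I \<noteq> bot"
    using convex_on_imp_convex[OF assms(1)] assms(2-4)
    by (intro is_interval_imp_nontrivial_at[of _ _ y]) (auto simp: is_interval_convex_1)
  show "eventually (\<lambda>z. 0 \<le> (f z - f x) / (z - x)) (at x within I)"
    unfolding eventually_at_filter
  proof (rule always_eventually, safe)
    fix z assume "z \<noteq> x" "z \<in> I"
    with convex_on_deriv_mono[OF assms(1) this(2) assms(2) F]
    show "0 \<le> (f z - f x) / (z - x)" by (auto simp: zero_le_divide_iff zero_le_mult_iff)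
  qed
qed

text \<open>The mean value theorem stands in for integrating \<open>g'\<close>; at the ends of the
  interval only one-sided derivatives enter.\<close>

lemma deriv_within_nonneg_imp_le:
  fixes g :: "real \<Rightarrow> real"
  assumes "a \<le> b" and g: "\<And>x. x \<in> {a..b} \<Longrightarrow> (g has_real_derivative g' x) (at x within {a..b})"
    and "\<And>x. x \<in> {a..b} \<Longrightarrow> 0 \<le> g' x"
  shows "g a \<le> g b"
proof (cases "a = b")
  case False
  with assms(1) have "a < b" by simp
  then obtain x where "x \<in> {a<..<b}" "g b - g a = g' x * (b - a)"
    using mvt_simple[of a b g "\<lambda>x h. g' x * h"] g by (auto simp: has_field_derivative_def)
  then show ?thesis using assms(3)[of x] \<open>a < b\<close>
    by (smt (verit) atLeastAtMost_iff greaterThanLessThan_iff mult_nonneg_nonneg)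
qed auto

section \<open>Chords and the trapezoid rules\<close>

definition chord :: "(real \<Rightarrow> real) \<Rightarrow> real \<Rightarrow> real \<Rightarrow> real \<Rightarrow> real"
  where "chord k a b x = k a + (k b - k a) / (b - a) * (x - a)"

lemma convex_on_le_chord:
  assumes "convex_on I k" "a \<in> I" "b \<in> I" "a < b" "x \<in> {a..b}"
  shows "k x \<le> chord k a b x"
proof -
  define t where "t = (x - a) / (b - a)"
  have t: "0 \<le> t" "t \<le> 1" "t * (b - a) = x - a" using assms(4,5) by (auto simp: t_def)
  have "k ((1 - t) *\<^sub>R a + t *\<^sub>R b) \<le> (1 - t) * k a + t * k b"
    using convex_onD[OF assms(1) t(1,2) assms(2,3)] .
  moreover have "(1 - t) *\<^sub>R a + t *\<^sub>R b = x" using t(3) by (simp add: algebra_simps)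
  moreover have "(1 - t) * k a + t * k b = chord k a b x"
  proof -
    have "(k b - k a) / (b - a) * (x - a) = t * (k b - k a)" by (simp add: t_def)
    then show ?thesis unfolding chord_def by (simp add: algebra_simps)
  qed
  ultimately show ?thesis by simp
qed

lemma subset_Icc_of_interval:
  fixes I :: "real set"
  shows "is_interval I \<Longrightarrow> a \<in> I \<Longrightarrow> b \<in> I \<Longrightarrow> {a..b} \<subseteq> I"
  using mem_is_interval_1_I[of I a b] by auto

text \<open>The trapezoid value is the integral of the chord of \<open>f'\<close>, and a convex
  \<open>f'\<close> lies below its chord. The auxiliary function \<open>?g\<close> is an
  antiderivative of the gap, so comparing \<open>?g a\<close> with \<open>?g b\<close> gives the
  inequality.\<close>

lemma trapezoid_convex_less:
  fixes f f' :: "real \<Rightarrow> real"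
  assumes "is_interval I" "convex_on I f'" "a \<in> I" "b \<in> I" "a < b"
    and f: "\<And>x. x \<in> I \<Longrightarrow> (f has_real_derivative f' x) (at x within I)"
  shows "f b - f a \<le> (b - a) * (f' a + f' b) / 2"
proof -
  note sub = subset_Icc_of_interval[OF assms(1,3,4)]
  define m where "m = (f' b - f' a) / (b - a)"
  have m: "m * (b - a) = f' b - f' a" using assms by (simp add: m_def)
  let ?g = "\<lambda>x. f' a * (x - a) + m * (x - a)\<^sup>2 / 2 - f x"
  have "?g a \<le> ?g b"
  proof (rule deriv_within_nonneg_imp_le[where g = ?g and a = a and b = b])
    fix x assume x: "x \<in> {a..b}"
    show "(?g has_real_derivative (chord f' a b x - f' x)) (at x within {a..b})"
      using has_field_derivative_subset[OF f sub, of x] x sub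
      unfolding chord_def m_def[symmetric] by (auto intro!: derivative_eq_intros)
    show "0 \<le> chord f' a b x - f' x"
      using convex_on_le_chord[OF assms(2-5) x] by simp
  qed (use assms in auto)
  moreover have "m * (b - a)\<^sup>2 = (f' b - f' a) * (b - a)"
    using m by (simp add: power2_eq_square mult.assoc[symmetric])
  ultimately have "0 \<le> f' a * (b - a) + (f' b - f' a) * (b - a) / 2 - (f b - f a)" by simp
  then show ?thesis by (simp add: field_simps)
qed

lemma trapezoid_convex:
  fixes f f' :: "real \<Rightarrow> real"
  assumes "is_interval I" "convex_on I f'" "x \<in> I" "y \<in> I"
    and f: "\<And>x. x \<in> I \<Longrightarrow> (f has_real_derivative f' x) (at x within I)"
  shows "(f x - f y) * (x - y) \<le> (x - y)\<^sup>2 * (f' x + f' y) / 2"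
proof -
  consider "x < y" | "x = y" | "y < x" by linarith
  then show ?thesis
  proof cases
    case 1
    from trapezoid_convex_less[OF assms(1-4) 1 f]
    have "(f y - f x) * (y - x) \<le> ((y - x) * (f' x + f' y) / 2) * (y - x)"
      by (rule mult_right_mono) (use 1 in auto)
    then show ?thesis by (simp add: power2_eq_square algebra_simps)
  next
    case 3
    from trapezoid_convex_less[OF assms(1,2,4,3) 3 f]
    have "(f x - f y) * (x - y) \<le> ((x - y) * (f' y + f' x) / 2) * (x - y)"
      by (rule mult_right_mono) (use 3 in auto)
    then show ?thesis by (simp add: power2_eq_square algebra_simps)
  qed auto
qed

text \<open>
  The derivative of \<open>(x - a) (b - x) f''/2 - (a + b - 2 x) f'/2 - f\<close> is \<open>(x - a) (b - x) f'''/2\<close>.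
  Subtracting the same expression for the quartic whose third derivative is the chord of \<open>f'''\<close>
  gives a function that is monotone if \<open>f'''\<close> lies below its chord.
\<close>

lemma corrected_trapezoid_aux:
  fixes f f' f'' f''' :: "real \<Rightarrow> real"
  assumes "is_interval I" "a \<in> I" "b \<in> I" "a < b"
    and f: "\<And>x. x \<in> I \<Longrightarrow> (f has_real_derivative f' x) (at x within I)"
    and f': "\<And>x. x \<in> I \<Longrightarrow> (f' has_real_derivative f'' x) (at x within I)"
    and f'': "\<And>x. x \<in> I \<Longrightarrow> (f'' has_real_derivative f''' x) (at x within I)"
  obtains \<Psi> where
    "\<And>x. x \<in> {a..b} \<Longrightarrow>
      (\<Psi> has_real_derivative (x - a) * (b - x) / 2 * (chord f''' a b x - f''' x)) (at x within {a..b})"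
    "\<Psi> b - \<Psi> a = f b - f a - (b - a) * (f' a + f' b) / 2 + (b - a) ^ 3 * (f''' a + f''' b) / 24"
proof -
  note sub = subset_Icc_of_interval[OF assms(1-3)]
  define p where "p = f''' a"
  define q where "q = (f''' b - f''' a) / (b - a)"
  define \<phi> where "\<phi> x = p * (x - a) ^ 3 / 6 + q * (x - a) ^ 4 / 24 - f x" for x
  define \<phi>' where "\<phi>' x = p * (x - a) ^ 2 / 2 + q * (x - a) ^ 3 / 6 - f' x" for x
  define \<phi>'' where "\<phi>'' x = p * (x - a) + q * (x - a) ^ 2 / 2 - f'' x" for x
  define \<Psi> where "\<Psi> x = (x - a) * (b - x) / 2 * \<phi>'' x - (a + b - 2 * x) / 2 * \<phi>' x - \<phi> x" for x
  have q: "q * (b - a) = f''' b - f''' a" using assms by (simp add: q_def)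
  show thesis
  proof (rule that[of \<Psi>])
    fix x assume x: "x \<in> {a..b}"
    then have xI: "x \<in> I" using sub by auto
    note ff = has_field_derivative_subset[OF f[OF xI] sub] has_field_derivative_subset[OF f'[OF xI] sub]
      has_field_derivative_subset[OF f''[OF xI] sub]
    have ch: "chord f''' a b x = p + q * (x - a)" by (simp add: chord_def p_def q_def)
    have d: "(\<phi> has_real_derivative \<phi>' x) (at x within {a..b})"
      "(\<phi>' has_real_derivative \<phi>'' x) (at x within {a..b})"
      "(\<phi>'' has_real_derivative chord f''' a b x - f''' x) (at x within {a..b})"
      unfolding \<phi>_def \<phi>'_def \<phi>''_def ch
      by (rule derivative_eq_intros ff refl | (simp add: field_simps power2_eq_square power3_eq_cube; fail))+
    show "(\<Psi> has_real_derivative (x - a) * (b - x) / 2 * (chord f''' a b x - f''' x)) (at x within {a..b})"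
      unfolding \<Psi>_def
      by (auto intro!: derivative_eq_intros d simp: field_simps)
  next
    \<comment> \<open>Origin of 1/24: the kernel (x - a) (b - x) / 2 has integral d^3 / 12 and is
      symmetric about the midpoint, so it integrates the chord of \<open>f'''\<close> to d^3 / 12
      times the mean of the two endpoint values.\<close>
    define d where "d = b - a"
    have qd: "q * d = f''' b - p" using q by (simp add: d_def p_def)
    have q3: "q * d ^ 3 = (f''' b - p) * d\<^sup>2" and q4: "q * d ^ 4 = (f''' b - p) * d ^ 3"
      by (simp_all add: qd[symmetric] power2_eq_square power3_eq_cube power4_eq_xxxx)
    \<comment> \<open>The factor (x - a) (b - x) vanishes at both ends and removes
      \<open>\<phi>''\<close>, which is why \<open>f''\<close> is absent from the rule.\<close>
    have "\<Psi> b = d / 2 * \<phi>' b - \<phi> b" "\<Psi> a = - d / 2 * \<phi>' a - \<phi> a"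
      by (simp_all add: \<Psi>_def d_def field_simps)
    moreover have "\<phi>' a = - f' a" "\<phi> a = - f a" by (simp_all add: \<phi>_def \<phi>'_def)
    moreover have "\<phi>' b = p * d\<^sup>2 / 2 + (f''' b - p) * d\<^sup>2 / 6 - f' b"
      "\<phi> b = p * d ^ 3 / 6 + (f''' b - p) * d ^ 3 / 24 - f b"
      by (simp_all add: \<phi>_def \<phi>'_def d_def[symmetric] q3 q4)
    ultimately have "\<Psi> b - \<Psi> a = f b - f a - d * (f' a + f' b) / 2 + d ^ 3 * (p + f''' b) / 24"
      by (simp add: power2_eq_square power3_eq_cube field_simps)
    then show "\<Psi> b - \<Psi> a = f b - f a - (b - a) * (f' a + f' b) / 2 + (b - a) ^ 3 * (f''' a + f''' b) / 24"
      by (simp add: d_def p_def)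
  qed
qed

text \<open>The derivative of \<open>\<Psi>\<close> is a nonnegative kernel times the gap between
  the chord and the convex function \<open>f'''\<close>, so \<open>\<Psi>\<close> increases. In the
  equality case it has the same value at both ends, hence is constant; its derivative vanishes, and
  since the kernel is positive at interior points the gap is zero there.\<close>

lemma corrected_trapezoid_convex_less:
  fixes f f' f'' f''' :: "real \<Rightarrow> real"
  assumes "is_interval I" "a \<in> I" "b \<in> I" "a < b" "convex_on I f'''"
    and f: "\<And>x. x \<in> I \<Longrightarrow> (f has_real_derivative f' x) (at x within I)"
    and f': "\<And>x. x \<in> I \<Longrightarrow> (f' has_real_derivative f'' x) (at x within I)"
    and f'': "\<And>x. x \<in> I \<Longrightarrow> (f'' has_real_derivative f''' x) (at x within I)"
  shows "f b - f a \<ge> (b - a) * (f' a + f' b) / 2 - (b - a) ^ 3 * (f''' a + f''' b) / 24"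
    and "f b - f a = (b - a) * (f' a + f' b) / 2 - (b - a) ^ 3 * (f''' a + f''' b) / 24 \<Longrightarrow>
      x \<in> {a..b} \<Longrightarrow> f''' x = chord f''' a b x"
proof -
  obtain \<Psi> where \<Psi>: "\<And>x. x \<in> {a..b} \<Longrightarrow>
      (\<Psi> has_real_derivative (x - a) * (b - x) / 2 * (chord f''' a b x - f''' x)) (at x within {a..b})"
    and eq: "\<Psi> b - \<Psi> a = f b - f a - (b - a) * (f' a + f' b) / 2 + (b - a) ^ 3 * (f''' a + f''' b) / 24"
    by (rule corrected_trapezoid_aux[OF assms(1-4) f f' f'']) blast+
  have mono: "\<Psi> c \<le> \<Psi> d" if "a \<le> c" "c \<le> d" "d \<le> b" for c d
  proof (rule deriv_within_nonneg_imp_le[where g = \<Psi> and g' = "\<lambda>x. (x - a) * (b - x) / 2 * (chord f''' a b x - f''' x)"])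
    fix x assume "x \<in> {c..d}"
    then have x: "x \<in> {a..b}" using that by auto
    show "(\<Psi> has_real_derivative (x - a) * (b - x) / 2 * (chord f''' a b x - f''' x)) (at x within {c..d})"
      using has_field_derivative_subset[OF \<Psi>[OF x], of "{c..d}"] that by auto
    show "0 \<le> (x - a) * (b - x) / 2 * (chord f''' a b x - f''' x)"
      using convex_on_le_chord[OF assms(5,2-4) x] x by (intro mult_nonneg_nonneg) auto
  qed (use that in auto)
  show "f b - f a \<ge> (b - a) * (f' a + f' b) / 2 - (b - a) ^ 3 * (f''' a + f''' b) / 24"
    using mono[of a b] eq assms by simp
  assume e: "f b - f a = (b - a) * (f' a + f' b) / 2 - (b - a) ^ 3 * (f''' a + f''' b) / 24"
    and x: "x \<in> {a..b}"
  show "f''' x = chord f''' a b x"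
  proof (cases "x = a \<or> x = b")
    case True
    then show ?thesis using assms(4) by (auto simp: chord_def)
  next
    case False
    have const: "\<Psi> y = \<Psi> a" if "y \<in> {a..b}" for y
    proof (rule antisym)
      have "\<Psi> b = \<Psi> a" using eq e by simp
      then show "\<Psi> y \<le> \<Psi> a" using mono[of y b] that by simp
      show "\<Psi> a \<le> \<Psi> y" using mono[of a y] that by simp
    qed
    have "(\<Psi> has_real_derivative 0) (at x within {a..b})"
      by (rule has_field_derivative_transform_within[OF DERIV_const[of "\<Psi> a"] zero_less_one x])
         (rule const[symmetric])
    moreover have "at x within {a..b} \<noteq> bot"
      by (rule is_interval_imp_nontrivial_at[of _ _ a]) (use False x in \<open>auto simp: is_interval_cc\<close>)
    ultimately have "(x - a) * (b - x) / 2 * (chord f''' a b x - f''' x) = 0"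
      using has_field_derivative_unique[OF \<Psi>[OF x]] by blast
    then show ?thesis using False x by auto
  qed
qed

text \<open>Multiplying the rule on [u, v] by v - u > 0 makes both sides symmetric in the two
  points, so their order no longer matters.\<close>

lemma corrected_trapezoid_convex:
  fixes f f' f'' f''' :: "real \<Rightarrow> real"
  assumes "is_interval I" "x \<in> I" "y \<in> I" "convex_on I f'''"
    and f: "\<And>x. x \<in> I \<Longrightarrow> (f has_real_derivative f' x) (at x within I)"
    and f': "\<And>x. x \<in> I \<Longrightarrow> (f' has_real_derivative f'' x) (at x within I)"
    and f'': "\<And>x. x \<in> I \<Longrightarrow> (f'' has_real_derivative f''' x) (at x within I)"
  shows "(f x - f y) * (x - y) \<ge>
    (x - y)\<^sup>2 * (f' x + f' y) / 2 - (x - y) ^ 4 * (f''' x + f''' y) / 24"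
proof -
  have less: "(f v - f u) * (v - u) \<ge>
      (v - u)\<^sup>2 * (f' u + f' v) / 2 - (v - u) ^ 4 * (f''' u + f''' v) / 24"
    if "u \<in> I" "v \<in> I" "u < v" for u v
  proof -
    have eq: "d\<^sup>2 * S / 2 - d ^ 4 * R / 24 = (d * S / 2 - d ^ 3 * R / 24) * d" for d S R :: real
      by (simp add: power2_eq_square power3_eq_cube power4_eq_xxxx field_simps)
    show ?thesis
      unfolding eq
      by (rule mult_right_mono[OF corrected_trapezoid_convex_less(1)[OF assms(1) that assms(4) f f' f'']])
         (use that in auto)
  qed
  have "(x - y) ^ 4 = (y - x) ^ 4"
    by (simp add: power4_eq_xxxx algebra_simps)
  then show ?thesis
    using less[of x y] less[of y x] assms(2,3) power2_commute[of x y]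
    by (cases x y rule: linorder_cases) (auto simp: algebra_simps)
qed


section \<open>Polynomials of bounded degree on an interval\<close>

lemma polynomial_onI: "degree p \<le> d \<Longrightarrow> (\<And>x. x \<in> I \<Longrightarrow> F x = poly p x) \<Longrightarrow> polynomial_on I d F"
  by (auto simp: polynomial_on_def)

lemma polynomial_on_one_iff:
  "polynomial_on I 1 g \<longleftrightarrow> (\<exists>\<alpha> \<beta>. \<forall>x\<in>I. g x = \<alpha> + \<beta> * x)"
proof
  assume "polynomial_on I 1 g"
  then obtain p where p: "degree p \<le> 1" "\<And>x. x \<in> I \<Longrightarrow> g x = poly p x"
    by (auto simp: polynomial_on_def)
  have "p = [:coeff p 0, coeff p 1:]"
    using p(1) by (intro poly_eqI) (auto simp: coeff_pCons intro: coeff_eq_0 split: nat.split)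
  then have "poly p x = coeff p 0 + coeff p 1 * x" for x
    by (metis mult.commute mult_zero_left poly_pCons poly_0 add.right_neutral)
  with p(2) have "\<forall>x\<in>I. g x = coeff p 0 + coeff p 1 * x" by simp
  then show "\<exists>\<alpha> \<beta>. \<forall>x\<in>I. g x = \<alpha> + \<beta> * x" by blast
next
  assume "\<exists>\<alpha> \<beta>. \<forall>x\<in>I. g x = \<alpha> + \<beta> * x"
  then obtain \<alpha> \<beta> where "\<And>x. x \<in> I \<Longrightarrow> g x = \<alpha> + \<beta> * x" by blast
  then show "polynomial_on I 1 g"
    by (intro polynomial_onI[of "[:\<alpha>, \<beta>:]"]) (auto simp: mult.commute)
qed

text \<open>Jensen's inequality is an equality for affine functions. Equality cases can thus be read
  off from two opposite bounds holding together.\<close>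

lemma polynomial_on_one_imp_convex_concave:
  assumes "polynomial_on I 1 g" "is_interval I"
  shows "convex_on I g" "concave_on I g"
proof -
  obtain \<alpha> \<beta> where g: "\<And>x. x \<in> I \<Longrightarrow> g x = \<alpha> + \<beta> * x"
    using assms(1) unfolding polynomial_on_one_iff by blast
  have I: "convex I" using assms(2) by (simp add: is_interval_convex_1)
  have "g (u *\<^sub>R x + v *\<^sub>R y) = u * g x + v * g y"
    if "x \<in> I" "y \<in> I" "u \<ge> 0" "v \<ge> 0" "u + v = 1" for u v x y
  proof -
    have "u *\<^sub>R x + v *\<^sub>R y \<in> I" using convexD[OF I] that by blast
    moreover have "\<alpha> = u * \<alpha> + v * \<alpha>" using that by (simp add: distrib_right[symmetric])
    ultimately show ?thesis using that by (simp add: g algebra_simps)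
  qed
  then show "convex_on I g" "concave_on I g"
    using I by (auto simp: convex_on_def concave_on_iff)
qed

text \<open>The polynomial \<open>q\<close> is the termwise antiderivative of \<open>p\<close>, and
  G - q has derivative 0 on an interval, so it is constant.\<close>

lemma polynomial_on_Suc_of_deriv:
  assumes "is_interval I" "polynomial_on I d g"
    and G: "\<And>x. x \<in> I \<Longrightarrow> (G has_real_derivative g x) (at x within I)"
  shows "polynomial_on I (Suc d) G"
proof -
  obtain p where p: "degree p \<le> d" "\<And>x. x \<in> I \<Longrightarrow> g x = poly p x"
    using assms(2) by (auto simp: polynomial_on_def)
  define q where "q = (\<Sum>i\<le>d. monom (coeff p i / real (Suc i)) (Suc i))"
  have "pderiv q = (\<Sum>i\<le>d. monom (coeff p i) i)"
    unfolding q_def higher_pderiv_sum[of 1, simplified] by (intro sum.cong) (auto simp: pderiv_monom simp del: of_nat_Suc)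
  also have "\<dots> = p"
  proof (rule poly_eqI)
    fix n
    show "coeff (\<Sum>i\<le>d. monom (coeff p i) i) n = coeff p n"
      using coeff_eq_0[of p n] p(1) by (cases "n \<le> d") (auto simp: coeff_sum)
  qed
  finally have q: "pderiv q = p" .
  have deg: "degree q \<le> Suc d"
    unfolding q_def by (intro degree_sum_le) (auto intro: order_trans[OF degree_monom_le])
  have "((\<lambda>x. G x - poly q x) has_real_derivative 0) (at x within I)" if "x \<in> I" for x
    using DERIV_diff[OF G[OF that] has_field_derivative_at_within[OF poly_DERIV[of q x]]]
    by (simp add: q p(2)[OF that])
  then obtain c where c: "\<And>x. x \<in> I \<Longrightarrow> G x - poly q x = c"
    using has_field_derivative_zero_constant[of I "\<lambda>x. G x - poly q x"] assms(1)
    by (auto simp: is_interval_convex_1)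
  show ?thesis
  proof (rule polynomial_onI)
    show "degree (q + [:c:]) \<le> Suc d" using deg by (intro degree_add_le) auto
    show "G x = poly (q + [:c:]) x" if "x \<in> I" for x using c[OF that] by simp
  qed
qed

lemma polynomial_on_deriv:
  assumes "is_interval I" "polynomial_on I (Suc d) G"
    and G: "\<And>x. x \<in> I \<Longrightarrow> (G has_real_derivative g x) (at x within I)"
  shows "polynomial_on I d g"
proof (cases "\<exists>x y. x \<in> I \<and> y \<in> I \<and> x \<noteq> y")
  case True
  obtain p where p: "degree p \<le> Suc d" "\<And>x. x \<in> I \<Longrightarrow> G x = poly p x"
    using assms(2) by (auto simp: polynomial_on_def)
  show ?thesis
  proof (rule polynomial_onI)
    show "degree (pderiv p) \<le> d" using p(1) by (simp add: degree_pderiv)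
    fix x assume x: "x \<in> I"
    with True obtain y where "y \<in> I" "x \<noteq> y" by metis
    then have "at x within I \<noteq> bot" using is_interval_imp_nontrivial_at assms(1) x by blast
    moreover have "(G has_real_derivative poly (pderiv p) x) (at x within I)"
      by (rule has_field_derivative_transform_within[OF
          has_field_derivative_at_within[OF poly_DERIV[of p x]] zero_less_one x])
        (simp add: p(2))
    ultimately show "g x = poly (pderiv p) x"
      using has_field_derivative_unique[OF G[OF x]] by blast
  qed
next
  \<comment> \<open>With at most one point in \<open>I\<close> the derivative does not determine
    \<open>g\<close>, but a constant polynomial fits a single value and has degree at most any
    \<open>d\<close>.\<close>
  case False
  show ?thesis
  proof (cases "I = {}")
    case True
    then show ?thesis by (intro polynomial_onI[of 0]) auto
  next
    case nonempty: False
    then obtain c where "c \<in> I" by blast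
    then have "x = c" if "x \<in> I" for x using False that by blast
    then show ?thesis by (intro polynomial_onI[of "[:g c:]"]) auto
  qed
qed

text \<open>The line is the one through two fixed points of the graph; a third point may lie to the
  left of, between or to the right of them, and each position is an instance of the hypothesis. That
  hypothesis is stated without division so that it matches what the quadrature equalities
  deliver.\<close>

lemma collinear_imp_polynomial_on_one:
  fixes g :: "real \<Rightarrow> real"
  assumes g: "\<And>a b c. a \<in> I \<Longrightarrow> b \<in> I \<Longrightarrow> c \<in> I \<Longrightarrow> a < b \<Longrightarrow> b < c \<Longrightarrow>
      (c - a) * g b = (c - b) * g a + (b - a) * g c"
  shows "polynomial_on I 1 g"
proof (cases "\<exists>x y. x \<in> I \<and> y \<in> I \<and> x < y")
  case True
  then obtain a b where ab: "a \<in> I" "b \<in> I" "a < b" by blast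
  define m where "m = (g b - g a) / (b - a)"
  have m: "m * (b - a) = g b - g a" using ab by (simp add: m_def)
  have "g x = (g a - m * a) + m * x" if x: "x \<in> I" for x
  proof -
    have "(b - a) * g x = (b - a) * g a + (g b - g a) * (x - a)"
    proof -
      consider "x < a" | "x = a" | "a < x \<and> x < b" | "x = b" | "b < x" by linarith
      then show ?thesis
      proof cases
        case 1 then show ?thesis using g[of x a b] ab x by (simp add: algebra_simps)
      next
        case 3 then show ?thesis using g[of a x b] ab x by (simp add: algebra_simps)
      next
        case 5 then show ?thesis using g[of a b x] ab x by (simp add: algebra_simps)
      qed (auto simp: algebra_simps)
    qed
    also have "\<dots> = (b - a) * ((g a - m * a) + m * x)"
      by (simp add: m[symmetric] algebra_simps)
    finally show ?thesis using ab by simp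
  qed
  then show ?thesis unfolding polynomial_on_one_iff by blast
next
  case False
  show ?thesis
  proof (cases "I = {}")
    case True
    then show ?thesis by (intro polynomial_onI[of 0]) auto
  next
    case nonempty: False
    then obtain c where "c \<in> I" by blast
    then have "x = c" if "x \<in> I" for x using False that by (meson linorder_neqE)
    then show ?thesis by (intro polynomial_onI[of "[:g c:]"]) auto
  qed
qed

section \<open>Concave versions and equality cases of the quadrature rules\<close>

lemma trapezoid_concave:
  fixes f f' :: "real \<Rightarrow> real"
  assumes "is_interval I" "concave_on I f'" "x \<in> I" "y \<in> I"
    and f: "\<And>x. x \<in> I \<Longrightarrow> (f has_real_derivative f' x) (at x within I)"
  shows "(f x - f y) * (x - y) \<ge> (x - y)\<^sup>2 * (f' x + f' y) / 2"
  using trapezoid_convex[OF assms(1) _ assms(3,4) DERIV_minus[OF f]] assms(2)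
  by (simp add: concave_on_def algebra_simps add_divide_distrib diff_divide_distrib)

lemma corrected_trapezoid_concave:
  fixes f f' f'' f''' :: "real \<Rightarrow> real"
  assumes "is_interval I" "x \<in> I" "y \<in> I" "concave_on I f'''"
    and f: "\<And>x. x \<in> I \<Longrightarrow> (f has_real_derivative f' x) (at x within I)"
    and f': "\<And>x. x \<in> I \<Longrightarrow> (f' has_real_derivative f'' x) (at x within I)"
    and f'': "\<And>x. x \<in> I \<Longrightarrow> (f'' has_real_derivative f''' x) (at x within I)"
  shows "(f x - f y) * (x - y) \<le>
    (x - y)\<^sup>2 * (f' x + f' y) / 2 - (x - y) ^ 4 * (f''' x + f''' y) / 24"
  using corrected_trapezoid_convex[OF assms(1-3) _ DERIV_minus[OF f] DERIV_minus[OF f'] DERIV_minus[OF f'']] assms(4)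
  by (simp add: concave_on_def algebra_simps add_divide_distrib diff_divide_distrib)

text \<open>Increments of \<open>f\<close> add up, so the trapezoids over [a, b] and [b, c] have
  together the area of the trapezoid over [a, c]. The triangle formed by the three points of the
  graph of \<open>f'\<close> therefore has area 0.\<close>

lemma trapezoid_equality_imp_polynomial_on:
  fixes f f' :: "real \<Rightarrow> real"
  assumes eq: "\<And>x y. x \<in> I \<Longrightarrow> y \<in> I \<Longrightarrow> x < y \<Longrightarrow>
    (f y - f x) * (y - x) = (y - x)\<^sup>2 * (f' y + f' x) / 2"
  shows "polynomial_on I 1 f'"
proof (rule collinear_imp_polynomial_on_one)
  fix a b c assume abc: "a \<in> I" "b \<in> I" "c \<in> I" "a < b" "b < c"
  have e: "2 * (f y - f x) = (y - x) * (f' y + f' x)" if "x \<in> I" "y \<in> I" "x < y" for x y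
    using eq[OF that] that by (simp add: power2_eq_square)
  have "(b - a) * (f' b + f' a) + (c - b) * (f' c + f' b) = (c - a) * (f' c + f' a)"
    using e[of a b] e[of b c] e[of a c] abc by simp
  then show "(c - a) * f' b = (c - b) * f' a + (b - a) * f' c"
    by (simp add: algebra_simps)
qed

text \<open>Equality on [a, c] says that a weighted integral of the gap between \<open>f'''\<close>
  and its chord is 0. As the gap has one sign, it vanishes throughout [a, c], so every intermediate
  point of the graph is collinear with the two ends.\<close>

lemma corrected_trapezoid_equality_imp_polynomial_on:
  fixes f f' f'' f''' :: "real \<Rightarrow> real"
  assumes I: "is_interval I" and conv: "convex_on I f''' \<or> concave_on I f'''"
    and f: "\<And>x. x \<in> I \<Longrightarrow> (f has_real_derivative f' x) (at x within I)"
    and f': "\<And>x. x \<in> I \<Longrightarrow> (f' has_real_derivative f'' x) (at x within I)"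
    and f'': "\<And>x. x \<in> I \<Longrightarrow> (f'' has_real_derivative f''' x) (at x within I)"
    and eq: "\<And>x y. x \<in> I \<Longrightarrow> y \<in> I \<Longrightarrow> x < y \<Longrightarrow>
      (f y - f x) * (y - x) = (y - x)\<^sup>2 * (f' y + f' x) / 2 - (y - x) ^ 4 * (f''' y + f''' x) / 24"
  shows "polynomial_on I 1 f'''"
proof (rule collinear_imp_polynomial_on_one)
  fix a b c assume abc: "a \<in> I" "b \<in> I" "c \<in> I" "a < b" "b < c"
  define d where "d = c - a"
  have "d > 0" using abc by (simp add: d_def)
  have "(f c - f a) * d = (d * (f' a + f' c) / 2 - d ^ 3 * (f''' a + f''' c) / 24) * d"
    using eq[of a c] abc unfolding d_def[symmetric]
    by (simp add: power2_eq_square power3_eq_cube power4_eq_xxxx field_simps)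
  then have e: "f c - f a = (c - a) * (f' a + f' c) / 2 - (c - a) ^ 3 * (f''' a + f''' c) / 24"
    using \<open>d > 0\<close> unfolding d_def[symmetric] by simp
  have ac: "a < c" and b: "b \<in> {a..c}" using abc by auto
  have "f''' b = chord f''' a c b"
    using conv
  proof
    assume "convex_on I f'''"
    from corrected_trapezoid_convex_less(2)[OF I abc(1,3) ac this f f' f'' e b] show ?thesis .
  next
    assume "concave_on I f'''"
    then have cc: "convex_on I (\<lambda>x. - f''' x)" by (simp add: concave_on_def)
    have "- f c - - f a = (c - a) * (- f' a + - f' c) / 2 - (c - a) ^ 3 * (- f''' a + - f''' c) / 24"
      using e by (simp add: algebra_simps add_divide_distrib diff_divide_distrib)
    from corrected_trapezoid_convex_less(2)[OF I abc(1,3) ac cc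
        DERIV_minus[OF f] DERIV_minus[OF f'] DERIV_minus[OF f''] this b]
    have "- f''' b = chord (\<lambda>x. - f''' x) a c b" .
    also have "\<dots> = - chord f''' a c b"
      using ac by (simp add: chord_def field_simps)
    finally show ?thesis by simp
  qed
  then have "(c - a) * f''' b = (c - a) * f''' a + (f''' c - f''' a) * (b - a)"
    using ac by (simp add: chord_def distrib_left)
  then show "(c - a) * f''' b = (c - b) * f''' a + (b - a) * f''' c"
    by (simp add: algebra_simps)
qed

section \<open>Perturbation of a diagonalization\<close>

lemma bounded_bilinear_matrix_mult:
  "bounded_bilinear ((**) :: complex^'n^'m \<Rightarrow> complex^'k^'n \<Rightarrow> complex^'k^'m)"
  unfolding bilinear_conv_bounded_bilinear[symmetric] bilinear_def
  by (auto intro!: linearI simp: vec_eq_iff matrix_matrix_mult_def algebra_simps sum.distrib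
      scaleR_sum_right)

lemma cadjoint_nth [simp]: "cadjoint A $ i $ j = cnj (A $ j $ i)"
  by (simp add: cadjoint_def)

lemma cadjoint_cadjoint [simp]: "cadjoint (cadjoint A) = A"
  by (simp add: vec_eq_iff)

lemma cadjoint_mult: "cadjoint (A ** B) = cadjoint B ** cadjoint A"
  by (simp add: vec_eq_iff matrix_matrix_mult_def mult.commute)

lemma bounded_linear_cadjoint: "bounded_linear (cadjoint :: complex^'n^'m \<Rightarrow> complex^'m^'n)"
  unfolding linear_conv_bounded_linear[symmetric]
  by (auto intro!: linearI simp: vec_eq_iff)

text \<open>The argument of \<open>rdiag\<close> is a function, so it is differentiated one entry at
  a time: a one-entry matrix depends linearly on that entry. Frames are treated in the same way,
  column by column.\<close>

lemma bounded_linear_rdiag: "bounded_linear (\<lambda>x. rdiag (\<lambda>i. if i = j then x else 0) :: complex^'n^'n)"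
  unfolding linear_conv_bounded_linear[symmetric]
  by (auto intro!: linearI simp: vec_eq_iff rdiag_def scaleR_conv_of_real[where 'a = complex])

lemma rdiag_eq_sum: "rdiag d = (\<Sum>j\<in>UNIV. rdiag (\<lambda>i. if i = j then d j else 0))"
  by (simp add: vec_eq_iff rdiag_def if_distrib[of complex_of_real] cong: if_cong)

lemma has_vector_derivative_rdiag:
  assumes "\<And>j. (d j has_vector_derivative d' j) F"
  shows "((\<lambda>s. rdiag (\<lambda>j. d j s)) has_vector_derivative rdiag d') F"
  unfolding rdiag_eq_sum[of "\<lambda>j. d j _"] rdiag_eq_sum[of d']
  by (intro has_vector_derivative_sum bounded_linear.has_vector_derivative[OF bounded_linear_rdiag] assms)

lemma rtrace_cyclic: "rtrace (A ** B) = rtrace (B ** A)"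
  unfolding rtrace_def trace_def matrix_matrix_mult_def
  by (simp, subst sum.swap) (simp add: mult.commute)

lemma rtrace_rdiag_mult: "rtrace (rdiag d ** A) = (\<Sum>j\<in>UNIV. d j * Re (A $ j $ j))"
  by (simp add: rtrace_def trace_def rdiag_matrix_mult)

lemma rtrace_unitary_conj:
  assumes "unitary U"
  shows "rtrace (U ** A ** cadjoint U) = rtrace A"
  using assms rtrace_cyclic[of "U ** A" "cadjoint U"]
  by (simp add: matrix_mul_assoc unitary_def)

section \<open>Eigenframes and traces of the functional calculus\<close>

definition frame :: "('n \<Rightarrow> complex^'n) \<Rightarrow> complex^'n^'n"
  where "frame v = (\<chi> i j. v j $ i)"

lemma cadjoint_frame_frame: "(cadjoint (frame v) ** frame w) $ j $ k = cinner (v j) (w k)"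
  by (simp add: frame_def cinner_def matrix_matrix_mult_def)

lemma bounded_linear_frame_column: "bounded_linear (\<lambda>x. frame (\<lambda>j. if j = k then x else 0))"
  unfolding linear_conv_bounded_linear[symmetric]
  by (auto intro!: linearI simp: vec_eq_iff frame_def)

lemma frame_eq_sum: "frame v = (\<Sum>k\<in>UNIV. frame (\<lambda>j. if j = k then v k else 0))"
  by (simp add: vec_eq_iff frame_def if_distrib[of "\<lambda>x. x $ _"] cong: if_cong)

lemma has_vector_derivative_frame:
  assumes "\<And>j. (v j has_vector_derivative v' j) F"
  shows "((\<lambda>s. frame (\<lambda>j. v j s)) has_vector_derivative frame v') F"
  unfolding frame_eq_sum[of "\<lambda>j. v j _"] frame_eq_sum[of v']
  by (intro has_vector_derivative_sum bounded_linear.has_vector_derivative[OF bounded_linear_frame_column] assms)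

text \<open>Read column by column, the eigenvalue equations say H V = V diag(d). Orthonormality
  makes the adjoint of V a left inverse, which for square matrices is also a right inverse and can
  be moved to the other side.\<close>

lemma frame_diagonalizes:
  assumes "\<And>j k. cinner (v j) (v k) = (if j = k then 1 else 0)"
    and "\<And>j. H *v v j = complex_of_real (d j) *s v j"
  shows "unitary (frame v)" and "H = frame v ** rdiag d ** cadjoint (frame v)"
proof -
  have "cadjoint (frame v) ** frame v = mat 1"
    by (simp add: vec_eq_iff cadjoint_frame_frame assms(1) mat_def)
  moreover from this have u: "frame v ** cadjoint (frame v) = mat 1"
    by (simp add: matrix_left_right_inverse)
  ultimately show "unitary (frame v)" by (simp add: unitary_def)
  have "(H ** frame v) $ i $ j = (H *v v j) $ i" for i j
    by (simp add: matrix_matrix_mult_def matrix_vector_mult_def frame_def)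
  then have "H ** frame v = frame v ** rdiag d"
    by (simp add: vec_eq_iff assms(2) matrix_mult_rdiag frame_def mult.commute)
  then have "frame v ** rdiag d ** cadjoint (frame v) = H ** (frame v ** cadjoint (frame v))"
    by (simp add: matrix_mul_assoc)
  then show "H = frame v ** rdiag d ** cadjoint (frame v)"
    by (simp add: u)
qed

lemma rtrace_fun_calc:
  assumes "unitary U" and "H = U ** rdiag d ** cadjoint U"
  shows "rtrace (fun_calc g H) = (\<Sum>j\<in>UNIV. g (d j))"
    and "rtrace (fun_calc g H ** A) = (\<Sum>j\<in>UNIV. g (d j) * Re ((cadjoint U ** A ** U) $ j $ j))"
proof -
  have "rtrace (fun_calc g H) = rtrace (rdiag (\<lambda>i. g (d i)) ** mat 1)"
    by (simp add: fun_calc_eq[OF assms] rtrace_unitary_conj[OF assms(1)])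
  then show "rtrace (fun_calc g H) = (\<Sum>j\<in>UNIV. g (d j))"
    unfolding rtrace_rdiag_mult by (simp add: mat_def)
  have "rtrace (fun_calc g H ** A) = rtrace (U ** (rdiag (\<lambda>i. g (d i)) ** cadjoint U ** A))"
    by (simp add: fun_calc_eq[OF assms] matrix_mul_assoc)
  also have "\<dots> = rtrace (rdiag (\<lambda>i. g (d i)) ** (cadjoint U ** A ** U))"
    by (subst rtrace_cyclic) (simp add: matrix_mul_assoc)
  finally show "rtrace (fun_calc g H ** A) = (\<Sum>j\<in>UNIV. g (d j) * Re ((cadjoint U ** A ** U) $ j $ j))"
    by (simp add: rtrace_rdiag_mult)
qed

lemma weighted_double_sum_nonneg:
  fixes w g :: "'n::finite \<Rightarrow> 'n \<Rightarrow> real"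
  assumes "\<And>j k. w j k \<ge> 0" "\<And>j k. g j k \<ge> 0"
  shows "(\<Sum>j\<in>UNIV. \<Sum>k\<in>UNIV. w j k * g j k) \<ge> 0"
  by (intro sum_nonneg mult_nonneg_nonneg assms)

lemma weighted_double_sum_nonpos:
  fixes w g :: "'n::finite \<Rightarrow> 'n \<Rightarrow> real"
  assumes "\<And>j k. w j k \<ge> 0" "\<And>j k. g j k \<le> 0"
  shows "(\<Sum>j\<in>UNIV. \<Sum>k\<in>UNIV. w j k * g j k) \<le> 0"
  by (intro sum_nonpos mult_nonneg_nonpos assms)

text \<open>A symmetric weight sees only the symmetric part of \<open>g\<close>. This is where signs
  appear: f_j (l_j - l_k) has none, while its symmetric part (f_j - f_k) (l_j - l_k) / 2 is
  controlled by monotonicity.\<close>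

lemma sum_symmetrize:
  fixes w :: "'n::finite \<Rightarrow> 'n \<Rightarrow> real"
  assumes "\<And>j k. w j k = w k j"
  shows "(\<Sum>j\<in>UNIV. \<Sum>k\<in>UNIV. w j k * g j k) = (\<Sum>j\<in>UNIV. \<Sum>k\<in>UNIV. w j k * ((g j k + g k j) / 2))"
proof -
  have "(\<Sum>j\<in>UNIV. \<Sum>k\<in>UNIV. w j k * g j k) = (\<Sum>j\<in>UNIV. \<Sum>k\<in>UNIV. w j k * g k j)"
    by (subst sum.swap) (simp add: assms)
  then show ?thesis
    by (simp add: distrib_left add_divide_distrib sum.distrib sum_divide_distrib[symmetric])
qed

text \<open>
  The primes stand for derivatives along the family: the first two hypotheses are the derivatives of
  \<open>H U = U diag(l)\<close> and of \<open>U* U = 1\<close>.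
\<close>

locale diagonalized_velocity =
  fixes U H H' U' :: "complex^'n^'n" and l l' :: "'n \<Rightarrow> real"
  assumes deriv_eigen: "H' ** U + H ** U' = U' ** rdiag l + U ** rdiag l'"
    and deriv_unitary: "cadjoint U' ** U + cadjoint U ** U' = 0"
    and U: "unitary U"
    and H: "H = U ** rdiag l ** cadjoint U"
    and H'_hermitian: "hermitian H'"
begin

text \<open>\<open>A\<close> is the infinitesimal rotation of the eigenframe, expressed in that
  frame, and \<open>h\<close> is the velocity of \<open>H\<close> in the same coordinates.\<close>

definition "A = cadjoint U ** U'"
definition "h = cadjoint U ** H' ** U"
definition "w j k = (cmod (A $ j $ k))\<^sup>2"

lemma UU: "cadjoint U ** U = mat 1" "U ** cadjoint U = mat 1"
  using U by (auto simp: unitary_def)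

lemma U'_eq: "U' = U ** A"
  by (simp add: A_def matrix_mul_assoc UU)

lemma A_antihermitian: "cnj (A $ j $ k) = - A $ k $ j"
proof -
  have "cadjoint U' ** U = cadjoint A" by (simp add: A_def cadjoint_mult)
  then have "cadjoint A = - A"
    using deriv_unitary by (simp add: A_def eq_neg_iff_add_eq_0)
  then have "cadjoint A $ k $ j = - A $ k $ j" by simp
  then show ?thesis by simp
qed

lemma w_sym: "w j k = w k j"
  unfolding w_def by (metis A_antihermitian complex_mod_cnj norm_minus_cancel)

text \<open>Multiplying the differentiated eigenvalue equation by the adjoint of U gives h + diag(l)
  A = A diag(l) + diag(l'). Its diagonal is the Hellmann-Feynman formula, its off-diagonal part
  first order perturbation theory. It is never solved for \<open>A\<close>, so coinciding
  eigenvalues are allowed.\<close>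

lemma h_nth: "h $ j $ k = A $ j $ k * of_real (l k - l j) + (if j = k then of_real (l' j) else 0)"
proof -
  have "cadjoint U ** H = rdiag l ** cadjoint U"
    by (simp add: H matrix_mul_assoc UU)
  then have "cadjoint U ** (H' ** U + H ** U') = h + rdiag l ** A"
    by (simp add: matrix_add_ldistrib h_def A_def matrix_mul_assoc)
  moreover have "cadjoint U ** (U' ** rdiag l + U ** rdiag l') = A ** rdiag l + rdiag l'"
    by (simp add: matrix_add_ldistrib A_def matrix_mul_assoc UU)
  ultimately have "(h + rdiag l ** A) $ j $ k = (A ** rdiag l + rdiag l') $ j $ k"
    by (simp add: deriv_eigen)
  then show ?thesis
    by (simp add: rdiag_matrix_mult matrix_mult_rdiag algebra_simps) (simp add: rdiag_def)
qed

lemma h_diag: "h $ j $ j = of_real (l' j)"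
  by (simp add: h_nth)

lemma h_hermitian: "cnj (h $ j $ k) = h $ k $ j"
  by (simp add: h_nth A_antihermitian algebra_simps)

text \<open>There is no mixed term, because l_j - l_k is 0 on the diagonal.\<close>

lemma norm_h: "(cmod (h $ j $ k))\<^sup>2 = w j k * (l j - l k)\<^sup>2 + (if j = k then (l' j)\<^sup>2 else 0)"
  by (auto simp: h_nth w_def norm_mult power_mult_distrib power2_commute simp flip: of_real_diff)

text \<open>In the eigenbasis the trace is the sum of g(l_j) |h_jk|^2. Its diagonal part is split
  off as the sum of g(l_j) (l_j')^2, which for g = f' cancels against the same sum in the second
  derivative of the trace.\<close>

lemma rtrace_square:
  "rtrace (H' ** fun_calc g H ** H') = (\<Sum>j\<in>UNIV. g (l j) * (l' j)\<^sup>2) +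
    (\<Sum>j\<in>UNIV. \<Sum>k\<in>UNIV. w j k * ((l j - l k)\<^sup>2 * (g (l j) + g (l k)) / 2))"
proof -
  have "rtrace (H' ** fun_calc g H ** H') = rtrace (fun_calc g H ** (H' ** H'))"
    unfolding matrix_mul_assoc[symmetric] by (subst rtrace_cyclic) (simp add: matrix_mul_assoc)
  also have "\<dots> = (\<Sum>j\<in>UNIV. g (l j) * Re ((cadjoint U ** (H' ** H') ** U) $ j $ j))"
    by (rule rtrace_fun_calc(2)[OF U H])
  also have "cadjoint U ** (H' ** H') ** U = cadjoint U ** H' ** (U ** cadjoint U) ** H' ** U"
    by (simp add: UU matrix_mul_assoc)
  also have "\<dots> = h ** h" by (simp add: h_def matrix_mul_assoc)
  also have "(\<Sum>j\<in>UNIV. g (l j) * Re ((h ** h) $ j $ j)) =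
      (\<Sum>j\<in>UNIV. \<Sum>k\<in>UNIV. g (l j) * (cmod (h $ j $ k))\<^sup>2)"
  proof (rule sum.cong[OF refl])
    fix j
    have "h $ j $ k * h $ k $ j = of_real ((cmod (h $ j $ k))\<^sup>2)" for k
      using complex_norm_square[of "h $ j $ k"] by (simp add: h_hermitian)
    then show "g (l j) * Re ((h ** h) $ j $ j) = (\<Sum>k\<in>UNIV. g (l j) * (cmod (h $ j $ k))\<^sup>2)"
      by (simp add: matrix_matrix_mult_def sum_distrib_left del: of_real_power)
  qed
  also have "\<dots> = (\<Sum>j\<in>UNIV. g (l j) * (l' j)\<^sup>2) + (\<Sum>j\<in>UNIV. \<Sum>k\<in>UNIV. w j k * (g (l j) * (l j - l k)\<^sup>2))"
    unfolding norm_h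
    by (simp add: distrib_left sum.distrib if_distrib[of "\<lambda>x. _ * x"] mult_ac cong: if_cong)
  finally show ?thesis
    unfolding sum_symmetrize[OF w_sym, where g = "\<lambda>j k. g (l j) * (l j - l k)\<^sup>2"]
    by (simp add: power2_commute algebra_simps)
qed

text \<open>Commuting with H multiplies the (j, k) entry of \<open>h\<close> by l_j - l_k. This
  kills the diagonal, raises the power of l_j - l_k in the sum from 2 to 4, and makes the matrix
  antihermitian, whence the minus sign.\<close>

lemma rtrace_commutator:
  "rtrace (fun_calc g H ** (commutator H H' ** commutator H H')) =
    - (\<Sum>j\<in>UNIV. \<Sum>k\<in>UNIV. w j k * ((l j - l k) ^ 4 * (g (l j) + g (l k)) / 2))"
proof -
  define c where "c = cadjoint U ** commutator H H' ** U"
  have "c = (cadjoint U ** U) ** rdiag l ** h - h ** rdiag l ** (cadjoint U ** U)"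
    unfolding c_def commutator_def h_def H
    by (simp add: bounded_bilinear.diff_left[OF bounded_bilinear_matrix_mult]
        bounded_bilinear.diff_right[OF bounded_bilinear_matrix_mult] matrix_mul_assoc)
  then have c_eq: "c = rdiag l ** h - h ** rdiag l" by (simp add: UU)
  have c_nth: "c $ j $ k = of_real (l j - l k) * h $ j $ k" for j k
    unfolding c_eq by (simp add: rdiag_matrix_mult matrix_mult_rdiag algebra_simps)
  have c: "c $ j $ k * c $ k $ j = - of_real ((l j - l k)\<^sup>2 * (cmod (h $ j $ k))\<^sup>2)" for j k
    unfolding c_nth using complex_norm_square[of "h $ j $ k"]
    by (simp add: h_hermitian power2_eq_square algebra_simps)
  have "rtrace (fun_calc g H ** (commutator H H' ** commutator H H')) =
      (\<Sum>j\<in>UNIV. g (l j) * Re ((cadjoint U ** (commutator H H' ** commutator H H') ** U) $ j $ j))"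
    by (rule rtrace_fun_calc(2)[OF U H])
  also have "cadjoint U ** (commutator H H' ** commutator H H') ** U =
      cadjoint U ** commutator H H' ** (U ** cadjoint U) ** commutator H H' ** U"
    by (simp add: UU matrix_mul_assoc)
  also have "\<dots> = c ** c" by (simp add: c_def matrix_mul_assoc)
  also have "(\<Sum>j\<in>UNIV. g (l j) * Re ((c ** c) $ j $ j)) =
      - (\<Sum>j\<in>UNIV. \<Sum>k\<in>UNIV. w j k * (g (l j) * (l j - l k) ^ 4))"
    unfolding sum_negf[symmetric]
  proof (rule sum.cong[OF refl])
    fix j
    have "Re ((c ** c) $ j $ j) = (\<Sum>k\<in>UNIV. - ((l j - l k)\<^sup>2 * (cmod (h $ j $ k))\<^sup>2))"
      by (simp add: matrix_matrix_mult_def c del: of_real_mult of_real_power)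
    also have "\<dots> = (\<Sum>k\<in>UNIV. - (w j k * (l j - l k) ^ 4))"
    proof (rule sum.cong[OF refl])
      fix k
      show "- ((l j - l k)\<^sup>2 * (cmod (h $ j $ k))\<^sup>2) = - (w j k * (l j - l k) ^ 4)"
        unfolding norm_h by (simp add: power4_eq_xxxx power2_eq_square)
    qed
    finally show "g (l j) * Re ((c ** c) $ j $ j) = (\<Sum>k\<in>UNIV. - (w j k * (g (l j) * (l j - l k) ^ 4)))"
      by (simp add: sum_distrib_left sum_negf mult_ac)
  qed
  finally show ?thesis
    unfolding sum_symmetrize[OF w_sym, where g = "\<lambda>j k. g (l j) * (l j - l k) ^ 4"]
    by (simp add: power4_eq_xxxx algebra_simps)
qed

text \<open>The hypothesis is the product rule for l_j' = h_jj. Its two terms with \<open>U'\<close>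
  are complex conjugate on the diagonal and contribute 2 w_jk (l_j - l_k), which away from crossings
  is the familiar 2 |h_jk|^2 / (l_j - l_k).\<close>

lemma sum_acceleration:
  assumes l'': "\<And>j. l'' j = Re ((cadjoint U' ** H' ** U + cadjoint U ** H'' ** U + cadjoint U ** H' ** U') $ j $ j)"
  shows "(\<Sum>j\<in>UNIV. g (l j) * l'' j) = rtrace (fun_calc g H ** H'') +
    (\<Sum>j\<in>UNIV. \<Sum>k\<in>UNIV. w j k * ((g (l j) - g (l k)) * (l j - l k)))"
proof -
  have l''_eq: "l'' j = Re ((cadjoint U ** H'' ** U) $ j $ j) + (\<Sum>k\<in>UNIV. w j k * (2 * (l j - l k)))" for j
  proof -
    have "cadjoint U' ** H' ** U = cadjoint A ** cadjoint U ** H' ** U"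
      by (rule arg_cong[where f = "\<lambda>M. M ** H' ** U"]) (rule arg_cong[OF U'_eq, of cadjoint, unfolded cadjoint_mult])
    also have "\<dots> = cadjoint A ** h" by (simp add: h_def matrix_mul_assoc)
    finally have "cadjoint U' ** H' ** U = cadjoint A ** h" .
    moreover have "cadjoint U ** H' ** U' = h ** A"
      unfolding h_def matrix_mul_assoc[symmetric] U'_eq[symmetric] ..
    ultimately have "l'' j = Re ((cadjoint U ** H'' ** U) $ j $ j) +
        Re (\<Sum>k\<in>UNIV. cnj (A $ k $ j) * h $ k $ j + h $ j $ k * A $ k $ j)"
      by (simp add: l'' matrix_matrix_mult_def sum.distrib)
    also have "Re (\<Sum>k\<in>UNIV. cnj (A $ k $ j) * h $ k $ j + h $ j $ k * A $ k $ j) =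
        (\<Sum>k\<in>UNIV. w j k * (2 * (l j - l k)))"
      unfolding Re_sum
    proof (rule sum.cong[OF refl])
      fix k
      have cn: "h $ j $ k * A $ k $ j = cnj (cnj (A $ k $ j) * h $ k $ j)"
        by (simp add: h_hermitian)
      have "Re (cnj (A $ k $ j) * h $ k $ j + h $ j $ k * A $ k $ j) = 2 * Re (cnj (A $ k $ j) * h $ k $ j)"
        unfolding cn by simp
      also have "Re (cnj (A $ k $ j) * h $ k $ j) = w j k * (l j - l k)"
      proof (cases "j = k")
        \<comment> \<open>The diagonal of an antihermitian matrix is imaginary and h_kk is real: a
          changing phase of an eigenvector leaves no trace.\<close>
        case True
        have "Re (A $ k $ k) = 0"
          using arg_cong[OF A_antihermitian[of k k], of Re] by simp
        with True show ?thesis by (simp add: h_diag)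
      next
        case False
        have "cnj (A $ k $ j) * A $ k $ j = of_real (w k j)"
          using complex_norm_square[of "A $ k $ j"] by (simp add: w_def mult.commute)
        then have "cnj (A $ k $ j) * h $ k $ j = of_real (w k j * (l j - l k))"
          using False by (simp add: h_nth mult.assoc[symmetric] del: of_real_diff)
        then show ?thesis using w_sym[of j k] by (simp only: Re_complex_of_real)
      qed
      finally show "Re (cnj (A $ k $ j) * h $ k $ j + h $ j $ k * A $ k $ j) = w j k * (2 * (l j - l k))"
        by simp
    qed
    finally show ?thesis .
  qed
  have "(\<Sum>j\<in>UNIV. g (l j) * l'' j) = rtrace (fun_calc g H ** H'') +
      (\<Sum>j\<in>UNIV. \<Sum>k\<in>UNIV. w j k * (2 * g (l j) * (l j - l k)))"
    by (simp add: l''_eq rtrace_fun_calc(2)[OF U H] distrib_left sum.distrib sum_distrib_left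
        right_diff_distrib mult_ac)
  moreover have "(2 * g (l j) * (l j - l k) + 2 * g (l k) * (l k - l j)) / 2 = (g (l j) - g (l k)) * (l j - l k)" for j k
    by (simp add: field_simps)
  ultimately show ?thesis
    using sum_symmetrize[OF w_sym, where g = "\<lambda>j k. 2 * g (l j) * (l j - l k)"] by simp
qed

end

section \<open>Analytic hermitian families and the second derivative of the trace\<close>

abbreviation coupling :: "('n \<Rightarrow> real \<Rightarrow> complex^'n) \<Rightarrow> real \<Rightarrow> 'n \<Rightarrow> 'n \<Rightarrow> real"
  where "coupling v \<tau> j k \<equiv> (cmod (cinner (v j \<tau>) (dot (v k) \<tau>)))\<^sup>2"

context
  fixes T I :: "real set" and H :: "real \<Rightarrow> complex^'n^'n" and ev v
  assumes fam: "hermitian_family T I H ev v" and T: "open T"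
begin

private definition U where "U s = frame (\<lambda>j. v j s)"
private definition U' where "U' s = frame (\<lambda>j. dot (v j) s)"

lemma family_analytic: "real_analytic_on H T" "real_analytic_on (ev j) T" "real_analytic_on (v j) T"
  using fam by (auto simp: hermitian_family_def)

lemma family_ev_in: "s \<in> T \<Longrightarrow> ev j s \<in> I"
  using fam by (auto simp: hermitian_family_def)

lemma family_unitary: "s \<in> T \<Longrightarrow> unitary (U s)"
  and family_diag: "s \<in> T \<Longrightarrow> H s = U s ** rdiag (\<lambda>j. ev j s) ** cadjoint (U s)"
  using fam frame_diagonalizes[of "\<lambda>j. v j s" "H s" "\<lambda>j. ev j s"]
  by (auto simp: U_def hermitian_family_def)

lemma family_U_deriv: "s \<in> T \<Longrightarrow> (U has_vector_derivative U' s) (at s)"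
  unfolding U_def[abs_def] U'_def
  by (intro has_vector_derivative_frame real_analytic_on_deriv(1)[OF family_analytic(3) T])

lemma family_H_deriv: "s \<in> T \<Longrightarrow> (H has_vector_derivative dot H s) (at s)"
  "s \<in> T \<Longrightarrow> (dot H has_vector_derivative dot (dot H) s) (at s)"
  by (auto intro: real_analytic_on_deriv family_analytic T)

lemma family_ev_deriv: "s \<in> T \<Longrightarrow> (ev j has_real_derivative dot (ev j) s) (at s)"
  "s \<in> T \<Longrightarrow> (dot (ev j) has_real_derivative dot (dot (ev j)) s) (at s)"
  unfolding has_real_derivative_iff_has_vector_derivative
  by (auto intro: real_analytic_on_deriv family_analytic T)

lemma family_H_deriv_hermitian:
  assumes "s \<in> T"
  shows "hermitian (dot H s)"
proof -
  have "((\<lambda>s. cadjoint (H s)) has_vector_derivative cadjoint (dot H s)) (at s)"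
    by (rule bounded_linear.has_vector_derivative[OF bounded_linear_cadjoint family_H_deriv(1)[OF assms]])
  then have "(H has_vector_derivative cadjoint (dot H s)) (at s)"
    by (rule has_vector_derivative_transform_within_open[OF _ T assms])
       (use fam in \<open>auto simp: hermitian_family_def hermitian_def\<close>)
  then show ?thesis
    unfolding hermitian_def using family_H_deriv(1)[OF assms] vector_derivative_unique_at by blast
qed

lemma family_velocity:
  assumes s: "s \<in> T"
  shows "diagonalized_velocity (U s) (H s) (dot H s) (U' s) (\<lambda>j. ev j s) (\<lambda>j. dot (ev j) s)"
proof
  note mult = bounded_bilinear.has_vector_derivative[OF bounded_bilinear_matrix_mult]
  have "((\<lambda>s. H s ** U s) has_vector_derivative H s ** U' s + dot H s ** U s) (at s)"
    by (rule mult[OF family_H_deriv(1)[OF s] family_U_deriv[OF s]])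
  moreover have "((\<lambda>s. U s ** rdiag (\<lambda>j. ev j s)) has_vector_derivative
      U s ** rdiag (\<lambda>j. dot (ev j) s) + U' s ** rdiag (\<lambda>j. ev j s)) (at s)"
    by (intro mult family_U_deriv s has_vector_derivative_rdiag
        family_ev_deriv[unfolded has_real_derivative_iff_has_vector_derivative])
  then have "((\<lambda>s. H s ** U s) has_vector_derivative
      U s ** rdiag (\<lambda>j. dot (ev j) s) + U' s ** rdiag (\<lambda>j. ev j s)) (at s)"
  proof (rule has_vector_derivative_transform_within_open[OF _ T s])
    fix t assume t: "t \<in> T"
    then show "U t ** rdiag (\<lambda>j. ev j t) = H t ** U t"
      using family_unitary[OF t] family_diag[OF t]
      by (simp add: unitary_def matrix_mul_assoc[symmetric])
  qed
  ultimately have "H s ** U' s + dot H s ** U s =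
      U s ** rdiag (\<lambda>j. dot (ev j) s) + U' s ** rdiag (\<lambda>j. ev j s)"
    by (rule vector_derivative_unique_at)
  then show "dot H s ** U s + H s ** U' s =
      U' s ** rdiag (\<lambda>j. ev j s) + U s ** rdiag (\<lambda>j. dot (ev j) s)"
    by (simp only: add.commute)
  have "((\<lambda>s. cadjoint (U s) ** U s) has_vector_derivative
      cadjoint (U s) ** U' s + cadjoint (U' s) ** U s) (at s)"
    by (intro mult family_U_deriv s bounded_linear.has_vector_derivative[OF bounded_linear_cadjoint])
  moreover have "((\<lambda>s. cadjoint (U s) ** U s) has_vector_derivative 0) (at s)"
    by (rule has_vector_derivative_transform_within_open[OF has_vector_derivative_const[of "mat 1"] T s])
       (use family_unitary in \<open>auto simp: unitary_def\<close>)
  ultimately have "cadjoint (U s) ** U' s + cadjoint (U' s) ** U s = 0"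
    by (rule vector_derivative_unique_at)
  then show "cadjoint (U' s) ** U s + cadjoint (U s) ** U' s = 0"
    by (simp only: add.commute)
qed (use family_unitary family_diag family_H_deriv_hermitian s in auto)

lemma family_coupling:
  assumes "s \<in> T"
  shows "diagonalized_velocity.w (U s) (U' s) j k = coupling v s j k"
  unfolding diagonalized_velocity.w_def[OF family_velocity[OF assms]]
    diagonalized_velocity.A_def[OF family_velocity[OF assms]]
  by (simp add: U_def U'_def cadjoint_frame_frame)

text \<open>Differentiating the identity l_j' = <v_j, H' v_j> instead of l_j twice, so that only
  first derivatives of the eigenvectors occur.\<close>

lemma family_acceleration:
  assumes s: "s \<in> T"
  shows "dot (dot (ev j)) s = Re ((cadjoint (U' s) ** dot H s ** U s +
    cadjoint (U s) ** dot (dot H) s ** U s + cadjoint (U s) ** dot H s ** U' s) $ j $ j)"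
    (is "_ = Re (?D $ j $ j)")
proof -
  note mult = bounded_bilinear.has_vector_derivative[OF bounded_bilinear_matrix_mult]
  have bl: "bounded_linear (\<lambda>M::complex^'n^'n. Re (M $ j $ j))"
    by (intro bounded_linear_compose[OF bounded_linear_Re] bounded_linear_compose[OF bounded_linear_vec_nth]
        bounded_linear_vec_nth)
  have "((\<lambda>s. cadjoint (U s) ** dot H s ** U s) has_vector_derivative
      cadjoint (U s) ** dot H s ** U' s + (cadjoint (U s) ** dot (dot H) s + cadjoint (U' s) ** dot H s) ** U s) (at s)"
    by (intro mult family_U_deriv family_H_deriv s bounded_linear.has_vector_derivative[OF bounded_linear_cadjoint])
  then have "((\<lambda>s. cadjoint (U s) ** dot H s ** U s) has_vector_derivative ?D) (at s)"
    by (simp add: bounded_bilinear.add_left[OF bounded_bilinear_matrix_mult] add_ac)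
  then have "((\<lambda>s. Re ((cadjoint (U s) ** dot H s ** U s) $ j $ j)) has_vector_derivative Re (?D $ j $ j)) (at s)"
    by (rule bounded_linear.has_vector_derivative[OF bl])
  then have "(dot (ev j) has_vector_derivative Re (?D $ j $ j)) (at s)"
  proof (rule has_vector_derivative_transform_within_open[OF _ T s])
    fix t assume t: "t \<in> T"
    show "Re ((cadjoint (U t) ** dot H t ** U t) $ j $ j) = dot (ev j) t"
      using diagonalized_velocity.h_diag[OF family_velocity[OF t], of j]
      unfolding diagonalized_velocity.h_def[OF family_velocity[OF t]] by simp
  qed
  then show ?thesis by (rule vector_derivative_at)
qed

context
  fixes F f f' :: "real \<Rightarrow> real"
  assumes F: "\<And>x. x \<in> I \<Longrightarrow> (F has_real_derivative f x) (at x within I)"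
    and f: "\<And>x. x \<in> I \<Longrightarrow> (f has_real_derivative f' x) (at x within I)"
begin

text \<open>An eigenvalue may sit at an endpoint of \<open>I\<close>, where \<open>G\<close> has
  only a one-sided derivative. The chain rule is therefore applied within the image of
  \<open>T\<close>, which lies in \<open>I\<close>; openness of \<open>T\<close> then gives a full
  derivative in the parameter.\<close>

lemma deriv_comp_ev:
  assumes s: "s \<in> T" and G: "\<And>x. x \<in> I \<Longrightarrow> (G has_real_derivative g x) (at x within I)"
  shows "((\<lambda>s. G (ev j s)) has_real_derivative g (ev j s) * dot (ev j) s) (at s)"
proof -
  have "(G has_real_derivative g (ev j s)) (at (ev j s) within ev j ` T)"
    by (rule has_field_derivative_subset[OF G]) (use s family_ev_in in auto)
  moreover have "(ev j has_real_derivative dot (ev j) s) (at s within T)"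
    by (rule has_field_derivative_at_within[OF family_ev_deriv(1)[OF s]])
  ultimately have "(G \<circ> ev j has_real_derivative g (ev j s) * dot (ev j) s) (at s within T)"
    by (rule DERIV_image_chain)
  then show ?thesis unfolding at_within_open[OF s T] o_def .
qed

lemma trace_fun_deriv:
  assumes s: "s \<in> T"
  shows "(trace_fun F H has_real_derivative (\<Sum>j\<in>UNIV. f (ev j s) * dot (ev j) s)) (at s)"
proof (rule has_field_derivative_transform_within_open[OF _ T s])
  show "((\<lambda>s. \<Sum>j\<in>UNIV. F (ev j s)) has_real_derivative (\<Sum>j\<in>UNIV. f (ev j s) * dot (ev j) s)) (at s)"
    by (intro DERIV_sum deriv_comp_ev F s)
qed (simp add: rtrace_fun_calc(1)[OF family_unitary family_diag])

lemma trace_fun_deriv2: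
  assumes s: "s \<in> T"
  shows "(deriv (trace_fun F H) has_real_derivative
    (\<Sum>j\<in>UNIV. f (ev j s) * dot (dot (ev j)) s) + (\<Sum>j\<in>UNIV. f' (ev j s) * (dot (ev j) s)\<^sup>2)) (at s)"
proof (rule has_field_derivative_transform_within_open[OF _ T s])
  have "((\<lambda>s. f (ev j s) * dot (ev j) s) has_real_derivative
      f (ev j s) * dot (dot (ev j)) s + f' (ev j s) * (dot (ev j) s)\<^sup>2) (at s)" for j
    using DERIV_mult[OF deriv_comp_ev[OF s f, of j] family_ev_deriv(2)[OF s, of j]]
    by (simp add: power2_eq_square mult_ac add_ac)
  from DERIV_sum[where S = UNIV, OF this]
  show "((\<lambda>s. \<Sum>j\<in>UNIV. f (ev j s) * dot (ev j) s) has_real_derivative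
      (\<Sum>j\<in>UNIV. f (ev j s) * dot (dot (ev j)) s) + (\<Sum>j\<in>UNIV. f' (ev j s) * (dot (ev j) s)\<^sup>2)) (at s)"
    by (simp add: sum.distrib)
qed (rule DERIV_imp_deriv[OF trace_fun_deriv, symmetric])

lemma trace_fun_differentiable:
  "s \<in> T \<Longrightarrow> trace_fun F H differentiable (at s)"
  "s \<in> T \<Longrightarrow> deriv (trace_fun F H) differentiable (at s)"
  using trace_fun_deriv trace_fun_deriv2 by (auto simp: real_differentiable_def)

lemma trace_fun_second_derivative:
  assumes s: "s \<in> T"
  shows "deriv (deriv (trace_fun F H)) s - bound_1 f f' H ev s =
    (\<Sum>j\<in>UNIV. \<Sum>k\<in>UNIV. coupling v s j k * ((f (ev j s) - f (ev k s)) * (ev j s - ev k s)))"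
  using diagonalized_velocity.sum_acceleration[OF family_velocity[OF s], OF family_acceleration[OF s], of f]
    DERIV_imp_deriv[OF trace_fun_deriv2[OF s]]
  by (simp add: family_coupling[OF s])

lemma trace_fun_bound_2:
  assumes s: "s \<in> T"
  shows "bound_2 f f' H s - deriv (deriv (trace_fun F H)) s =
    (\<Sum>j\<in>UNIV. \<Sum>k\<in>UNIV. coupling v s j k * ((ev j s - ev k s)\<^sup>2 * (f' (ev j s) + f' (ev k s)) / 2
      - (f (ev j s) - f (ev k s)) * (ev j s - ev k s)))"
  using trace_fun_second_derivative[OF s]
    diagonalized_velocity.rtrace_square[OF family_velocity[OF s], of f']
  by (simp add: family_coupling[OF s] right_diff_distrib sum_subtractf)

text \<open>An algebraic identity for an arbitrary \<open>g\<close>; only the corrected trapezoid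
  rule ties \<open>g\<close> to the third derivative of \<open>f\<close>. The half from symmetrizing
  the commutator trace turns 1/12 into 1/24.\<close>

lemma trace_fun_bound_3:
  assumes s: "s \<in> T"
  shows "deriv (deriv (trace_fun F H)) s - bound_3 f f' g H s =
    (\<Sum>j\<in>UNIV. \<Sum>k\<in>UNIV. coupling v s j k * ((f (ev j s) - f (ev k s)) * (ev j s - ev k s)
      - ((ev j s - ev k s)\<^sup>2 * (f' (ev j s) + f' (ev k s)) / 2
        - (ev j s - ev k s) ^ 4 * (g (ev j s) + g (ev k s)) / 24)))"
proof -
  have "(\<Sum>j\<in>UNIV. \<Sum>k\<in>UNIV. coupling v s j k * ((ev j s - ev k s) ^ 4 * (g (ev j s) + g (ev k s)) / 24)) =
    1 / 12 * (\<Sum>j\<in>UNIV. \<Sum>k\<in>UNIV. coupling v s j k * ((ev j s - ev k s) ^ 4 * (g (ev j s) + g (ev k s)) / 2))"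
    unfolding sum_distrib_left by (intro sum.cong) auto
  then show ?thesis
    using trace_fun_bound_2[OF s]
      diagonalized_velocity.rtrace_commutator[OF family_velocity[OF s], of g]
    by (simp add: family_coupling[OF s] right_diff_distrib sum_subtractf)
qed

text \<open>If \<open>I\<close> has a second point, then f' is nonnegative at the eigenvalue. If
  \<open>I\<close> is a single point, f' may be any number there, but the eigenvalue is constant and
  its velocity is 0.\<close>

lemma convex_on_imp_curvature_nonneg:
  assumes "convex_on I F" and s: "s \<in> T"
  shows "f' (ev j s) * (dot (ev j) s)\<^sup>2 \<ge> 0"
proof (cases "\<exists>y\<in>I. y \<noteq> ev j s")
  case True
  then obtain y where "y \<in> I" "ev j s \<noteq> y" by blast
  then have "f' (ev j s) \<ge> 0"
    using convex_on_deriv2_nonneg[OF assms(1) family_ev_in[OF s] _ _ F f[OF family_ev_in[OF s]]] by blast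
  then show ?thesis by simp
next
  case False
  have "(ev j has_vector_derivative 0) (at s)"
    by (rule has_vector_derivative_transform_within_open[OF has_vector_derivative_const[of "ev j s"] T s])
       (use False family_ev_in in metis)
  then show ?thesis by (simp add: vector_derivative_at)
qed

end

end

section \<open>Rotating families\<close>

lemma cinner_axis_left: "cinner (axis p 1) y = y $ p"
  by (simp add: cinner_def axis_def if_distrib[of cnj] if_distrib[of "\<lambda>x. x * _"] cong: if_cong)

lemma cinner_add_left: "cinner (x + x') y = cinner x y + cinner x' y"
  by (simp add: cinner_def distrib_right sum.distrib)

lemma cinner_diff_left: "cinner (x - x') y = cinner x y - cinner x' y"
  by (simp add: cinner_def left_diff_distrib sum_subtractf)

lemma cinner_scaleR_left: "cinner (r *\<^sub>R x) y = of_real r * cinner x y"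
  by (simp add: cinner_def sum_distrib_left scaleR_conv_of_real[where 'a = complex] mult_ac)

lemma matrix_vector_mult_scaleR: "(r *\<^sub>R A) *v x = r *\<^sub>R (A *v x)" for A :: "complex^'n^'m"
  by (simp add: vec_eq_iff matrix_vector_mult_def scaleR_sum_right)

text \<open>
  The spectral projection onto the rotating eigenvector is quadratic in \<open>cos \<tau>\<close> and \<open>sin \<tau>\<close>, hence
  linear in \<open>cos (2 \<tau>)\<close> and \<open>sin (2 \<tau>)\<close>.
\<close>

lemma rotating_family:
  fixes i0 i1 :: "'n::finite"
  assumes "i0 \<noteq> i1" and ab: "a \<in> I" "b \<in> I"
  obtains H :: "real \<Rightarrow> complex^'n^'n" and v where
    "hermitian_family T I H (\<lambda>j _. if j = i1 then b else a) v"
    "\<And>\<tau>. coupling v \<tau> i0 i1 = 1"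
proof -
  define E :: "'n \<Rightarrow> 'n \<Rightarrow> complex^'n^'n" where "E p q = (\<chi> i j. if i = p \<and> j = q then 1 else 0)" for p q
  \<comment> \<open>This is a + (b - a) P with P the orthogonal projection onto the vector with
    coordinates -sin s at \<open>i0\<close> and cos s at \<open>i1\<close>.\<close>
  define H where "H s = mat (complex_of_real a) + (b - a) *\<^sub>R (
      ((1 / 2) *\<^sub>R E i0 i0 + (1 / 2) *\<^sub>R E i1 i1)
      + cos (2 * s) *\<^sub>R ((1 / 2) *\<^sub>R E i1 i1 + (- 1 / 2) *\<^sub>R E i0 i0)
      + sin (2 * s) *\<^sub>R ((- 1 / 2) *\<^sub>R (E i0 i1 + E i1 i0)))" for s
  \<comment> \<open>The spelling \<open>cos (1 * s)\<close> and the sums of scaled constant vectors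
    follow the shape of the analyticity rules for \<open>cos (c * s)\<close> and for
    addition.\<close>
  define v where "v j s = (if j = i0 then cos (1 * s) *\<^sub>R axis i0 1 + sin (1 * s) *\<^sub>R axis i1 1
      else if j = i1 then sin (1 * s) *\<^sub>R ((- 1) *\<^sub>R axis i0 1) + cos (1 * s) *\<^sub>R axis i1 1
      else axis j (1::complex))" for j s
  have E_vec: "(E p q *v x) $ i = (if i = p then x $ q else 0)" for p q x i
    by (simp add: matrix_vector_mult_def E_def if_distrib[of "\<lambda>x. x * _"] cong: if_cong)
  have mat_vec: "(mat c *v x) $ i = c * x $ i" for c :: complex and x :: "complex^'n" and i
    by (simp add: matrix_vector_mult_def mat_def if_distrib[of "\<lambda>x. x * _"] cong: if_cong)
  have H_vec: "(H s *v x) $ i = of_real a * x $ i + of_real (b - a) * (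
      (if i = i0 then of_real ((sin s)\<^sup>2) * x $ i0 - of_real (sin s * cos s) * x $ i1 else 0) +
      (if i = i1 then of_real ((cos s)\<^sup>2) * x $ i1 - of_real (sin s * cos s) * x $ i0 else 0))" for s x i
  proof -
    have c0: "cos (2 * s) = 1 - 2 * (sin s)\<^sup>2" and c1: "cos (2 * s) = 2 * (cos s)\<^sup>2 - 1"
      by (rule cos_double_sin, rule cos_double_cos)
    have "(H s *v x) $ i = of_real a * x $ i + of_real (b - a) * (
        (if i = i0 then (1 / 2) * (1 - of_real (cos (2 * s))) * x $ i0 - (1 / 2) * of_real (sin (2 * s)) * x $ i1 else 0) +
        (if i = i1 then (1 / 2) * (1 + of_real (cos (2 * s))) * x $ i1 - (1 / 2) * of_real (sin (2 * s)) * x $ i0 else 0))"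
      unfolding H_def matrix_vector_mult_scaleR matrix_vector_mult_add_rdistrib
      by (simp add: E_vec mat_vec scaleR_conv_of_real[where 'a = complex] field_simps)
    also have "(1 / 2) * (1 - of_real (cos (2 * s))) = (of_real ((sin s)\<^sup>2) :: complex)"
      unfolding c0 by simp
    also have "(1 / 2) * (1 + of_real (cos (2 * s))) = (of_real ((cos s)\<^sup>2) :: complex)"
      unfolding c1 by simp
    also have "(1 / 2) * of_real (sin (2 * s)) = (of_real (sin s * cos s) :: complex)"
      by (simp add: sin_double)
    finally show ?thesis .
  qed
  have v_cinner: "cinner (v j s) y = (if j = i0 then of_real (cos s) * y $ i0 + of_real (sin s) * y $ i1
      else if j = i1 then - of_real (sin s) * y $ i0 + of_real (cos s) * y $ i1 else y $ j)" for j s y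
    by (simp add: v_def cinner_add_left cinner_diff_left cinner_scaleR_left cinner_axis_left)
  have one: "complex_of_real (sin s) * of_real (sin s) = 1 - of_real (cos s) * of_real (cos s)" for s
  proof -
    have "sin s * sin s = 1 - cos s * cos s"
      using sin_cos_squared_add[of s] by (simp add: power2_eq_square algebra_simps)
    from arg_cong[OF this, of complex_of_real] show ?thesis by simp
  qed
  have v_nth: "v j s $ i = (if j = i0 then if i = i0 then of_real (cos s) else if i = i1 then of_real (sin s) else 0
      else if j = i1 then if i = i0 then - of_real (sin s) else if i = i1 then of_real (cos s) else 0
      else if i = j then 1 else 0)" for j s i
    using \<open>i0 \<noteq> i1\<close> by (auto simp: v_def axis_def scaleR_conv_of_real[where 'a = complex])
  have "real_analytic_on H T"
    unfolding H_def[abs_def]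
    by (intro real_analytic_on_add real_analytic_on_const real_analytic_on_cos real_analytic_on_sin
        real_analytic_on_bounded_linear[OF bounded_linear_scaleR_right]
        real_analytic_on_bounded_linear[OF bounded_linear_scaleR_left])
  moreover have "real_analytic_on (v j) T" for j
  proof -
    have "real_analytic_on (\<lambda>s. cos (1 * s) *\<^sub>R axis i0 (1::complex) + sin (1 * s) *\<^sub>R axis i1 1) T"
      "real_analytic_on (\<lambda>s. sin (1 * s) *\<^sub>R ((- 1) *\<^sub>R axis i0 (1::complex)) + cos (1 * s) *\<^sub>R axis i1 1) T"
      by (intro real_analytic_on_add real_analytic_on_cos real_analytic_on_sin
          real_analytic_on_bounded_linear[OF bounded_linear_scaleR_left])+
    then show ?thesis
      unfolding v_def[abs_def] by (cases "j = i0"; cases "j = i1") (simp_all add: real_analytic_on_const)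
  qed
  moreover have "hermitian (H s)" for s
  proof -
    have "cnj (E p q $ j $ i) = E q p $ i $ j" for p q i j
      by (simp add: E_def conj_commute)
    moreover have "cnj (mat (complex_of_real a) $ j $ i) = mat (complex_of_real a) $ i $ j" for i j :: 'n
      by (simp add: mat_def)
    ultimately show ?thesis
      by (simp add: hermitian_def vec_eq_iff H_def add.commute)
  qed
  moreover have ip: "cinner (v j s) (v k s) = (if j = k then 1 else 0)" for j k s
  proof -
    note ne = \<open>i0 \<noteq> i1\<close> \<open>i0 \<noteq> i1\<close>[symmetric]
    consider "j = i0" | "j = i1" | "j \<noteq> i0" "j \<noteq> i1" by blast
    then show ?thesis
      unfolding v_cinner
      by cases (simp_all add: v_nth one ne mult.commute)
  qed
  moreover have "H s *v v j s = complex_of_real (if j = i1 then b else a) *s v j s" for j s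
  proof -
    have cc: "complex_of_real (cos s) * of_real (cos s) = 1 - of_real (sin s) * of_real (sin s)"
      by (simp add: one)
    have cc': "of_real (cos s) * (of_real (cos s) * z) = z - of_real (sin s) * (of_real (sin s) * z)" for z :: complex
      unfolding mult.assoc[symmetric] cc by (simp add: left_diff_distrib)
    have "(H s *v v j s) $ i = complex_of_real (if j = i1 then b else a) * v j s $ i" for i
      using \<open>i0 \<noteq> i1\<close> unfolding H_vec v_nth
      by (auto simp: power2_eq_square algebra_simps cc cc')
    then show ?thesis by (simp add: vec_eq_iff)
  qed
  ultimately have "hermitian_family T I H (\<lambda>j _. if j = i1 then b else a) v"
    using ab by (auto simp: hermitian_family_def real_analytic_on_const)
  moreover have "coupling v s i0 i1 = 1" for s
  proof -
    \<comment> \<open>The second rotating vector moves with velocity minus the first, so their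
      coupling is |<v_i0, -v_i0>|^2 = 1 for every s.\<close>
    have "((\<lambda>s. sin (1 * s) *\<^sub>R ((- 1) *\<^sub>R axis i0 (1::complex)) + cos (1 * s) *\<^sub>R axis i1 1) has_vector_derivative
        cos s *\<^sub>R ((- 1) *\<^sub>R axis i0 1) + (- sin s) *\<^sub>R axis i1 1) (at s)"
      by (intro has_vector_derivative_add bounded_linear.has_vector_derivative[OF bounded_linear_scaleR_left])
         (auto intro!: derivative_eq_intros simp: has_real_derivative_iff_has_vector_derivative[symmetric])
    moreover have "v i1 = (\<lambda>s. sin (1 * s) *\<^sub>R ((- 1) *\<^sub>R axis i0 (1::complex)) + cos (1 * s) *\<^sub>R axis i1 1)"
      using \<open>i0 \<noteq> i1\<close> by (simp add: v_def fun_eq_iff)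
    ultimately have "dot (v i1) s = cos s *\<^sub>R ((- 1) *\<^sub>R axis i0 1) + (- sin s) *\<^sub>R axis i1 1"
      by (simp only: vector_derivative_at)
    also have "\<dots> = - v i0 s" by (simp add: v_def)
    finally have "cinner (v i0 s) (dot (v i1) s) = - cinner (v i0 s) (v i0 s)"
      by (simp add: cinner_def sum_negf)
    then show ?thesis by (simp add: ip)
  qed
  ultimately show thesis by (rule that)
qed

text \<open>Pairs with equal eigenvalues drop out because B vanishes on the diagonal, and by
  symmetry all remaining pairs contribute the same value \<open>B a b\<close>. What is left is
  \<open>B a b\<close> times a total weight, which is at least the coupling 1 of \<open>i0\<close>
  and \<open>i1\<close>. Dimension at least 2 provides the plane to rotate in.\<close>

lemma rotating_family_test:
  fixes B :: "real \<Rightarrow> real \<Rightarrow> real"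
  assumes card: "CARD('n::finite) \<ge> 2" and T: "T \<noteq> {}"
    and B: "\<And>x. B x x = 0" "\<And>x y. B x y = B y x"
    and ab: "a \<in> I" "b \<in> I"
    and vanish: "\<And>(H :: real \<Rightarrow> complex^'n^'n) ev v \<tau>. hermitian_family T I H ev v \<Longrightarrow> \<tau> \<in> T \<Longrightarrow>
      (\<Sum>j\<in>UNIV. \<Sum>k\<in>UNIV. coupling v \<tau> j k * B (ev j \<tau>) (ev k \<tau>)) = 0"
  shows "B a b = 0"
proof -
  have "\<exists>i0 i1 :: 'n. i0 \<noteq> i1"
    using card card_le_Suc0_iff_eq[of "UNIV :: 'n set"] by auto
  then obtain i0 i1 :: 'n where i: "i0 \<noteq> i1" by blast
  obtain H :: "real \<Rightarrow> complex^'n^'n" and v where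
    fam: "hermitian_family T I H (\<lambda>j _. if j = i1 then b else a) v"
    and cpl: "\<And>\<tau>. coupling v \<tau> i0 i1 = 1"
    by (rule rotating_family[OF i ab, where T = T]) (rule that)
  obtain \<tau> where \<tau>: "\<tau> \<in> T" using T by blast
  let ?c = "\<lambda>j k. coupling v \<tau> j k * (if (j = i1) = (k = i1) then 0 else 1)"
  have "0 = (\<Sum>j\<in>UNIV. \<Sum>k\<in>UNIV. coupling v \<tau> j k * B (if j = i1 then b else a) (if k = i1 then b else a))"
    by (rule vanish[OF fam \<tau>, symmetric])
  also have "\<dots> = (\<Sum>j\<in>UNIV. \<Sum>k\<in>UNIV. ?c j k) * B a b"
    unfolding sum_distrib_right by (intro sum.cong refl) (auto simp: B(1) B(2)[of b a])
  finally have "(\<Sum>j\<in>UNIV. \<Sum>k\<in>UNIV. ?c j k) * B a b = 0" by simp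
  moreover have "1 \<le> (\<Sum>j\<in>UNIV. \<Sum>k\<in>UNIV. ?c j k)"
  proof -
    have "1 = ?c i0 i1" using i cpl by simp
    also have "\<dots> \<le> (\<Sum>k\<in>UNIV. ?c i0 k)" by (rule member_le_sum) auto
    also have "\<dots> \<le> (\<Sum>j\<in>UNIV. \<Sum>k\<in>UNIV. ?c j k)"
      by (rule member_le_sum[where f = "\<lambda>j. \<Sum>k\<in>UNIV. ?c j k"]) (auto intro!: sum_nonneg)
    finally show ?thesis .
  qed
  then have "(\<Sum>j\<in>UNIV. \<Sum>k\<in>UNIV. ?c j k) \<noteq> 0" by linarith
  ultimately show ?thesis unfolding mult_eq_0_iff by blast
qed

text \<open>Equality in (2) and (3) is understood over all families, since a single family tests the
  bracket only at its own eigenvalues. For 1 by 1 matrices all brackets vanish and equality holds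
  for every F, hence dimension at least 2 in the converses. Degrees are upper bounds. Existence of
  the second derivative is a separate claim because \<open>deriv\<close> is a total
  operator.\<close>

theorem theorem4p1:
  fixes I T :: "real set" and F f f' :: "real \<Rightarrow> real"
  assumes I: "is_interval I"
    and T: "is_interval T" "open T" "T \<noteq> {}"
    and F: "\<And>x. x \<in> I \<Longrightarrow> (F has_real_derivative f x) (at x within I)"
    and f: "\<And>x. x \<in> I \<Longrightarrow> (f has_real_derivative f' x) (at x within I)"
  shows
    \<comment> \<open>the second derivative of the trace exists\<close>
    "(\<forall>(H :: real \<Rightarrow> complex^'n^'n) ev v. hermitian_family T I H ev v \<longrightarrow>
        (\<forall>\<tau>\<in>T. trace_fun F H differentiable (at \<tau>) \<and>
               deriv (trace_fun F H) differentiable (at \<tau>)))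
   \<and> \<comment> \<open>(1)\<close>
     (\<forall>(H :: real \<Rightarrow> complex^'n^'n) ev v. hermitian_family T I H ev v \<longrightarrow>
        (convex_on I F \<longrightarrow>
           (\<forall>\<tau>\<in>T. deriv (deriv (trace_fun F H)) \<tau> \<ge> bound_1 f f' H ev \<tau>) \<and>
           ((\<forall>\<tau>\<in>T. dot (dot H) \<tau> = 0) \<longrightarrow> convex_on T (trace_fun F H))) \<and>
        (concave_on I F \<longrightarrow>
           (\<forall>\<tau>\<in>T. deriv (deriv (trace_fun F H)) \<tau> \<le> bound_1 f f' H ev \<tau>) \<and>
           ((\<forall>\<tau>\<in>T. dot (dot H) \<tau> = 0) \<longrightarrow> concave_on T (trace_fun F H))) \<and>
        ((\<exists>a b. \<forall>x\<in>I. F x = a * x + b) \<longrightarrow>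
           (\<forall>\<tau>\<in>T. deriv (deriv (trace_fun F H)) \<tau> = bound_1 f f' H ev \<tau>)))
   \<and> \<comment> \<open>(2)\<close>
     (convex_on I f' \<longrightarrow>
        (\<forall>(H :: real \<Rightarrow> complex^'n^'n) ev v. hermitian_family T I H ev v \<longrightarrow>
           (\<forall>\<tau>\<in>T. deriv (deriv (trace_fun F H)) \<tau> \<le> bound_2 f f' H \<tau>)))
   \<and> (concave_on I f' \<longrightarrow>
        (\<forall>(H :: real \<Rightarrow> complex^'n^'n) ev v. hermitian_family T I H ev v \<longrightarrow>
           (\<forall>\<tau>\<in>T. deriv (deriv (trace_fun F H)) \<tau> \<ge> bound_2 f f' H \<tau>)))
   \<and> (convex_on I f' \<or> concave_on I f' \<longrightarrow>
        (polynomial_on I 3 F \<longrightarrow>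
           (\<forall>(H :: real \<Rightarrow> complex^'n^'n) ev v. hermitian_family T I H ev v \<longrightarrow>
              (\<forall>\<tau>\<in>T. deriv (deriv (trace_fun F H)) \<tau> = bound_2 f f' H \<tau>))) \<and>
        (CARD('n) \<ge> 2 \<and>
           (\<forall>(H :: real \<Rightarrow> complex^'n^'n) ev v. hermitian_family T I H ev v \<longrightarrow>
              (\<forall>\<tau>\<in>T. deriv (deriv (trace_fun F H)) \<tau> = bound_2 f f' H \<tau>)) \<longrightarrow>
         polynomial_on I 3 F))
   \<and> \<comment> \<open>(3)\<close>
     (\<forall>f'' f'''.
        (\<forall>x\<in>I. (f' has_real_derivative f'' x) (at x within I)) \<and>
        (\<forall>x\<in>I. (f'' has_real_derivative f''' x) (at x within I)) \<and>
        continuous_on I f''' \<longrightarrow>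
        (convex_on I f''' \<longrightarrow>
           (\<forall>(H :: real \<Rightarrow> complex^'n^'n) ev v. hermitian_family T I H ev v \<longrightarrow>
              (\<forall>\<tau>\<in>T. deriv (deriv (trace_fun F H)) \<tau> \<ge> bound_3 f f' f''' H \<tau>))) \<and>
        (concave_on I f''' \<longrightarrow>
           (\<forall>(H :: real \<Rightarrow> complex^'n^'n) ev v. hermitian_family T I H ev v \<longrightarrow>
              (\<forall>\<tau>\<in>T. deriv (deriv (trace_fun F H)) \<tau> \<le> bound_3 f f' f''' H \<tau>))) \<and>
        (convex_on I f''' \<or> concave_on I f''' \<longrightarrow>
           (polynomial_on I 5 F \<longrightarrow>
              (\<forall>(H :: real \<Rightarrow> complex^'n^'n) ev v. hermitian_family T I H ev v \<longrightarrow>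
                 (\<forall>\<tau>\<in>T. deriv (deriv (trace_fun F H)) \<tau> = bound_3 f f' f''' H \<tau>))) \<and>
           (CARD('n) \<ge> 2 \<and>
              (\<forall>(H :: real \<Rightarrow> complex^'n^'n) ev v. hermitian_family T I H ev v \<longrightarrow>
                 (\<forall>\<tau>\<in>T. deriv (deriv (trace_fun F H)) \<tau> = bound_3 f f' f''' H \<tau>)) \<longrightarrow>
            polynomial_on I 5 F)))"
proof -
  note sub = T(2) F f
  have diff: "trace_fun F H differentiable (at \<tau>) \<and> deriv (trace_fun F H) differentiable (at \<tau>)"
    if "hermitian_family T I H ev v" "\<tau> \<in> T" for H :: "real \<Rightarrow> complex^'n^'n" and ev v \<tau>
    using trace_fun_differentiable[OF that(1) sub that(2)] by blast

  have b1_ge: "deriv (deriv (trace_fun F H)) \<tau> \<ge> bound_1 f f' H ev \<tau>"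
    if fam: "hermitian_family T I H ev v" and cv: "convex_on I F" and \<tau>: "\<tau> \<in> T"
    for H :: "real \<Rightarrow> complex^'n^'n" and ev v \<tau>
  proof -
    note in_I = family_ev_in[OF fam T(2) \<tau>]
    have "0 \<le> (f (ev j \<tau>) - f (ev k \<tau>)) * (ev j \<tau> - ev k \<tau>)" for j k
      by (rule convex_on_deriv_mono[OF cv in_I in_I F])
    then have "0 \<le> (\<Sum>j\<in>UNIV. \<Sum>k\<in>UNIV. coupling v \<tau> j k * ((f (ev j \<tau>) - f (ev k \<tau>)) * (ev j \<tau> - ev k \<tau>)))"
      by (intro weighted_double_sum_nonneg zero_le_power2)
    then show ?thesis using trace_fun_second_derivative[OF fam sub \<tau>] by linarith
  qed
  have b1_le: "deriv (deriv (trace_fun F H)) \<tau> \<le> bound_1 f f' H ev \<tau>"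
    if fam: "hermitian_family T I H ev v" and cc: "concave_on I F" and \<tau>: "\<tau> \<in> T"
    for H :: "real \<Rightarrow> complex^'n^'n" and ev v \<tau>
  proof -
    note in_I = family_ev_in[OF fam T(2) \<tau>]
    have le: "(f x - f y) * (x - y) \<le> 0" if "x \<in> I" "y \<in> I" for x y
      using convex_on_deriv_mono[OF cc[unfolded concave_on_def] that DERIV_minus[OF F]]
      by (simp add: algebra_simps)
    have "(\<Sum>j\<in>UNIV. \<Sum>k\<in>UNIV. coupling v \<tau> j k * ((f (ev j \<tau>) - f (ev k \<tau>)) * (ev j \<tau> - ev k \<tau>))) \<le> 0"
      by (intro weighted_double_sum_nonpos zero_le_power2 le in_I)
    then show ?thesis using trace_fun_second_derivative[OF fam sub \<tau>] by linarith
  qed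
  have cvx: "convex_on T (trace_fun F H)"
    if fam: "hermitian_family T I H ev v" and cv: "convex_on I F" and H: "\<forall>\<tau>\<in>T. dot (dot H) \<tau> = 0"
    for H :: "real \<Rightarrow> complex^'n^'n" and ev v
  proof (rule f''_ge0_imp_convex)
    fix \<tau> assume \<tau>: "\<tau> \<in> T"
    show "(trace_fun F H has_real_derivative deriv (trace_fun F H) \<tau>) (at \<tau>)"
      "(deriv (trace_fun F H) has_real_derivative deriv (deriv (trace_fun F H)) \<tau>) (at \<tau>)"
      using diff[OF fam \<tau>] by (auto simp: DERIV_deriv_iff_real_differentiable)
    \<comment> \<open>For vanishing second derivative of H, \<open>bound_1\<close> reduces to this
      sum.\<close>
    have "0 \<le> (\<Sum>j\<in>UNIV. f' (ev j \<tau>) * (dot (ev j) \<tau>)\<^sup>2)"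
      by (intro sum_nonneg convex_on_imp_curvature_nonneg[OF fam sub cv \<tau>])
    then show "0 \<le> deriv (deriv (trace_fun F H)) \<tau>"
      using b1_ge[OF fam cv \<tau>] H \<tau> by (simp add: rtrace_def trace_def matrix_matrix_mult_def)
  qed (use T in \<open>simp add: is_interval_convex_1\<close>)
  have ccv: "concave_on T (trace_fun F H)"
    if fam: "hermitian_family T I H ev v" and cc: "concave_on I F" and H: "\<forall>\<tau>\<in>T. dot (dot H) \<tau> = 0"
    for H :: "real \<Rightarrow> complex^'n^'n" and ev v
  proof (rule f''_le0_imp_concave)
    fix \<tau> assume \<tau>: "\<tau> \<in> T"
    show "(trace_fun F H has_real_derivative deriv (trace_fun F H) \<tau>) (at \<tau>)"
      "(deriv (trace_fun F H) has_real_derivative deriv (deriv (trace_fun F H)) \<tau>) (at \<tau>)"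
      using diff[OF fam \<tau>] by (auto simp: DERIV_deriv_iff_real_differentiable)
    have "f' (ev j \<tau>) * (dot (ev j) \<tau>)\<^sup>2 \<le> 0" for j
      using convex_on_imp_curvature_nonneg[OF fam T(2) DERIV_minus[OF F] DERIV_minus[OF f]
          cc[unfolded concave_on_def] \<tau>, of j] by simp
    then have "(\<Sum>j\<in>UNIV. f' (ev j \<tau>) * (dot (ev j) \<tau>)\<^sup>2) \<le> 0"
      by (intro sum_nonpos)
    then show "deriv (deriv (trace_fun F H)) \<tau> \<le> 0"
      using b1_le[OF fam cc \<tau>] H \<tau> by (simp add: rtrace_def trace_def matrix_matrix_mult_def)
  qed (use T in \<open>simp add: is_interval_convex_1\<close>)
  have affine: "convex_on I F \<and> concave_on I F" if ab: "\<exists>a b. \<forall>x\<in>I. F x = a * x + b"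
  proof -
    obtain a b where "\<forall>x\<in>I. F x = b + a * x" using ab by (auto simp: add.commute)
    then have "polynomial_on I 1 F" unfolding polynomial_on_one_iff by blast
    then show ?thesis using polynomial_on_one_imp_convex_concave I by blast
  qed
  have b1_eq: "deriv (deriv (trace_fun F H)) \<tau> = bound_1 f f' H ev \<tau>"
    if fam: "hermitian_family T I H ev v" and ab: "\<exists>a b. \<forall>x\<in>I. F x = a * x + b" and \<tau>: "\<tau> \<in> T"
    for H :: "real \<Rightarrow> complex^'n^'n" and ev v \<tau>
    using affine[OF ab] b1_ge[OF fam _ \<tau>] b1_le[OF fam _ \<tau>] by (intro antisym) auto

  have b2_le: "deriv (deriv (trace_fun F H)) \<tau> \<le> bound_2 f f' H \<tau>"
    if cv: "convex_on I f'" and fam: "hermitian_family T I H ev v" and \<tau>: "\<tau> \<in> T"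
    for H :: "real \<Rightarrow> complex^'n^'n" and ev v \<tau>
  proof -
    note in_I = family_ev_in[OF fam T(2) \<tau>]
    let ?B = "\<lambda>x y. (x - y)\<^sup>2 * (f' x + f' y) / 2 - (f x - f y) * (x - y)"
    have "?B (ev j \<tau>) (ev k \<tau>) \<ge> 0" for j k
      using trapezoid_convex[OF I cv in_I[of j] in_I[of k] f] by simp
    then have "(\<Sum>j\<in>UNIV. \<Sum>k\<in>UNIV. coupling v \<tau> j k * ?B (ev j \<tau>) (ev k \<tau>)) \<ge> 0"
      by (intro weighted_double_sum_nonneg zero_le_power2)
    then show ?thesis using trace_fun_bound_2[OF fam sub \<tau>] by linarith
  qed
  have b2_ge: "deriv (deriv (trace_fun F H)) \<tau> \<ge> bound_2 f f' H \<tau>"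
    if cc: "concave_on I f'" and fam: "hermitian_family T I H ev v" and \<tau>: "\<tau> \<in> T"
    for H :: "real \<Rightarrow> complex^'n^'n" and ev v \<tau>
  proof -
    note in_I = family_ev_in[OF fam T(2) \<tau>]
    let ?B = "\<lambda>x y. (x - y)\<^sup>2 * (f' x + f' y) / 2 - (f x - f y) * (x - y)"
    have "?B (ev j \<tau>) (ev k \<tau>) \<le> 0" for j k
      using trapezoid_concave[OF I cc in_I[of j] in_I[of k] f] by simp
    then have "(\<Sum>j\<in>UNIV. \<Sum>k\<in>UNIV. coupling v \<tau> j k * ?B (ev j \<tau>) (ev k \<tau>)) \<le> 0"
      by (intro weighted_double_sum_nonpos zero_le_power2)
    then show ?thesis using trace_fun_bound_2[OF fam sub \<tau>] by linarith
  qed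
  \<comment> \<open>A cubic F has an affine f', which is both convex and concave, so the two
    opposite bounds meet and give equality.\<close>
  have cubic: "convex_on I f' \<and> concave_on I f'" if "polynomial_on I 3 F"
  proof -
    have "polynomial_on I (Suc (Suc 1)) F" using that by (simp add: eval_nat_numeral)
    then have "polynomial_on I (Suc 1) f" by (rule polynomial_on_deriv[OF I _ F])
    then have "polynomial_on I 1 f'" by (rule polynomial_on_deriv[OF I _ f])
    then show ?thesis
      using polynomial_on_one_imp_convex_concave I by blast
  qed
  have b2_eq: "deriv (deriv (trace_fun F H)) \<tau> = bound_2 f f' H \<tau>"
    if "polynomial_on I 3 F" and fam: "hermitian_family T I H ev v" and \<tau>: "\<tau> \<in> T"
    for H :: "real \<Rightarrow> complex^'n^'n" and ev v \<tau>
    using cubic[OF that(1)] b2_le[OF _ fam \<tau>] b2_ge[OF _ fam \<tau>] by (intro antisym) auto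
  have b2_conv: "polynomial_on I 3 F"
    if card: "CARD('n) \<ge> 2"
      and eq: "\<forall>(H :: real \<Rightarrow> complex^'n^'n) ev v. hermitian_family T I H ev v \<longrightarrow>
        (\<forall>\<tau>\<in>T. deriv (deriv (trace_fun F H)) \<tau> = bound_2 f f' H \<tau>)"
  proof -
    let ?B = "\<lambda>x y. (x - y)\<^sup>2 * (f' x + f' y) / 2 - (f x - f y) * (x - y)"
    \<comment> \<open>The arguments are swapped to match the orientation y - x used by the equality
      criterion.\<close>
    have B: "?B y x = 0" if "x \<in> I" "y \<in> I" for x y
    proof (rule rotating_family_test[where 'n = 'n and B = ?B, OF card T(3) _ _ that(2,1)])
      fix H :: "real \<Rightarrow> complex^'n^'n" and ev v \<tau>
      assume fam: "hermitian_family T I H ev v" and \<tau>: "\<tau> \<in> T"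
      show "(\<Sum>j\<in>UNIV. \<Sum>k\<in>UNIV. coupling v \<tau> j k * ?B (ev j \<tau>) (ev k \<tau>)) = 0"
        using trace_fun_bound_2[OF fam sub \<tau>] eq[rule_format, OF fam \<tau>] by linarith
    next
      fix x y
      show "?B x y = ?B y x" by (simp add: power2_commute[of x y] algebra_simps)
    qed simp
    have "polynomial_on I 1 f'"
    proof (rule trapezoid_equality_imp_polynomial_on)
      fix x y assume "x \<in> I" "y \<in> I"
      from B[OF this] show "(f y - f x) * (y - x) = (y - x)\<^sup>2 * (f' y + f' x) / 2" by simp
    qed
    then have "polynomial_on I (Suc 1) f" by (rule polynomial_on_Suc_of_deriv[OF I _ f])
    then have "polynomial_on I (Suc (Suc 1)) F" by (rule polynomial_on_Suc_of_deriv[OF I _ F])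
    then show ?thesis by (simp add: eval_nat_numeral)
  qed

  have b3_ge: "deriv (deriv (trace_fun F H)) \<tau> \<ge> bound_3 f f' f''' H \<tau>"
    if f': "\<forall>x\<in>I. (f' has_real_derivative f'' x) (at x within I)"
      and f'': "\<forall>x\<in>I. (f'' has_real_derivative f''' x) (at x within I)"
      and cv: "convex_on I f'''" and fam: "hermitian_family T I H ev v" and \<tau>: "\<tau> \<in> T"
    for H :: "real \<Rightarrow> complex^'n^'n" and ev v \<tau> f'' f'''
  proof -
    note in_I = family_ev_in[OF fam T(2) \<tau>]
    let ?B = "\<lambda>x y. (f x - f y) * (x - y) -
      ((x - y)\<^sup>2 * (f' x + f' y) / 2 - (x - y) ^ 4 * (f''' x + f''' y) / 24)"
    have "?B (ev j \<tau>) (ev k \<tau>) \<ge> 0" for j k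
      using corrected_trapezoid_convex[OF I in_I[of j] in_I[of k] cv f f'[rule_format] f''[rule_format]] by simp
    then have "(\<Sum>j\<in>UNIV. \<Sum>k\<in>UNIV. coupling v \<tau> j k * ?B (ev j \<tau>) (ev k \<tau>)) \<ge> 0"
      by (intro weighted_double_sum_nonneg zero_le_power2)
    then show ?thesis using trace_fun_bound_3[OF fam sub \<tau>, where g = f'''] by linarith
  qed
  have b3_le: "deriv (deriv (trace_fun F H)) \<tau> \<le> bound_3 f f' f''' H \<tau>"
    if f': "\<forall>x\<in>I. (f' has_real_derivative f'' x) (at x within I)"
      and f'': "\<forall>x\<in>I. (f'' has_real_derivative f''' x) (at x within I)"
      and cc: "concave_on I f'''" and fam: "hermitian_family T I H ev v" and \<tau>: "\<tau> \<in> T"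
    for H :: "real \<Rightarrow> complex^'n^'n" and ev v \<tau> f'' f'''
  proof -
    note in_I = family_ev_in[OF fam T(2) \<tau>]
    let ?B = "\<lambda>x y. (f x - f y) * (x - y) -
      ((x - y)\<^sup>2 * (f' x + f' y) / 2 - (x - y) ^ 4 * (f''' x + f''' y) / 24)"
    have "?B (ev j \<tau>) (ev k \<tau>) \<le> 0" for j k
      using corrected_trapezoid_concave[OF I in_I[of j] in_I[of k] cc f f'[rule_format] f''[rule_format]] by simp
    then have "(\<Sum>j\<in>UNIV. \<Sum>k\<in>UNIV. coupling v \<tau> j k * ?B (ev j \<tau>) (ev k \<tau>)) \<le> 0"
      by (intro weighted_double_sum_nonpos zero_le_power2)
    then show ?thesis using trace_fun_bound_3[OF fam sub \<tau>, where g = f'''] by linarith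
  qed
  \<comment> \<open>Four differentiations take degree 5 to an affine \<open>f'''\<close>, for which
    the convex and the concave bound hold together.\<close>
  have quintic: "convex_on I f''' \<and> concave_on I f'''"
    if f': "\<forall>x\<in>I. (f' has_real_derivative f'' x) (at x within I)"
      and f'': "\<forall>x\<in>I. (f'' has_real_derivative f''' x) (at x within I)"
      and "polynomial_on I 5 F" for f'' f'''
  proof -
    have "polynomial_on I (Suc (Suc (Suc (Suc 1)))) F" using that(3) by (simp add: eval_nat_numeral)
    then have "polynomial_on I (Suc (Suc (Suc 1))) f" by (rule polynomial_on_deriv[OF I _ F])
    then have "polynomial_on I (Suc (Suc 1)) f'" by (rule polynomial_on_deriv[OF I _ f])
    then have "polynomial_on I (Suc 1) f''" by (rule polynomial_on_deriv[OF I _ f'[rule_format]])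
    then have "polynomial_on I 1 f'''" by (rule polynomial_on_deriv[OF I _ f''[rule_format]])
    then show ?thesis
      using polynomial_on_one_imp_convex_concave I by blast
  qed
  have b3_eq: "deriv (deriv (trace_fun F H)) \<tau> = bound_3 f f' f''' H \<tau>"
    if f': "\<forall>x\<in>I. (f' has_real_derivative f'' x) (at x within I)"
      and f'': "\<forall>x\<in>I. (f'' has_real_derivative f''' x) (at x within I)"
      and "polynomial_on I 5 F" and fam: "hermitian_family T I H ev v" and \<tau>: "\<tau> \<in> T"
    for H :: "real \<Rightarrow> complex^'n^'n" and ev v \<tau> f'' f'''
    using quintic[OF that(1-3)] b3_le[OF f' f'' _ fam \<tau>] b3_ge[OF f' f'' _ fam \<tau>] by (intro antisym) auto
  have b3_conv: "polynomial_on I 5 F"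
    if f': "\<forall>x\<in>I. (f' has_real_derivative f'' x) (at x within I)"
      and f'': "\<forall>x\<in>I. (f'' has_real_derivative f''' x) (at x within I)"
      and conv: "convex_on I f''' \<or> concave_on I f'''"
      and card: "CARD('n) \<ge> 2"
      and eq: "\<forall>(H :: real \<Rightarrow> complex^'n^'n) ev v. hermitian_family T I H ev v \<longrightarrow>
        (\<forall>\<tau>\<in>T. deriv (deriv (trace_fun F H)) \<tau> = bound_3 f f' f''' H \<tau>)" for f'' f'''
  proof -
    let ?B = "\<lambda>x y. (f x - f y) * (x - y) -
      ((x - y)\<^sup>2 * (f' x + f' y) / 2 - (x - y) ^ 4 * (f''' x + f''' y) / 24)"
    have B: "?B y x = 0" if "x \<in> I" "y \<in> I" for x y
    proof (rule rotating_family_test[where 'n = 'n and B = ?B, OF card T(3) _ _ that(2,1)])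
      fix H :: "real \<Rightarrow> complex^'n^'n" and ev v \<tau>
      assume fam: "hermitian_family T I H ev v" and \<tau>: "\<tau> \<in> T"
      show "(\<Sum>j\<in>UNIV. \<Sum>k\<in>UNIV. coupling v \<tau> j k * ?B (ev j \<tau>) (ev k \<tau>)) = 0"
        using trace_fun_bound_3[OF fam sub \<tau>, where g = f'''] eq[rule_format, OF fam \<tau>] by linarith
    next
      fix x y :: real
      have "(x - y) ^ 4 = (y - x) ^ 4" by (simp add: power4_eq_xxxx algebra_simps)
      then show "?B x y = ?B y x" by (simp add: power2_commute[of x y] algebra_simps)
    qed simp
    have "polynomial_on I 1 f'''"
    proof (rule corrected_trapezoid_equality_imp_polynomial_on[OF I conv f f'[rule_format] f''[rule_format]])
      fix x y assume "x \<in> I" "y \<in> I"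
      from B[OF this] show "(f y - f x) * (y - x) =
        (y - x)\<^sup>2 * (f' y + f' x) / 2 - (y - x) ^ 4 * (f''' y + f''' x) / 24" by simp
    qed
    then have "polynomial_on I (Suc 1) f''" by (rule polynomial_on_Suc_of_deriv[OF I _ f''[rule_format]])
    then have "polynomial_on I (Suc (Suc 1)) f'" by (rule polynomial_on_Suc_of_deriv[OF I _ f'[rule_format]])
    then have "polynomial_on I (Suc (Suc (Suc 1))) f" by (rule polynomial_on_Suc_of_deriv[OF I _ f])
    then have "polynomial_on I (Suc (Suc (Suc (Suc 1)))) F" by (rule polynomial_on_Suc_of_deriv[OF I _ F])
    then show ?thesis by (simp add: eval_nat_numeral)
  qed

  show ?thesis
    apply (intro conjI allI impI ballI; (elim conjE)?)
    using diff apply blast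
    using diff apply blast
    subgoal using b1_ge by blast
    subgoal using cvx by blast
    subgoal using b1_le by blast
    subgoal using ccv by blast
    subgoal using b1_eq by blast
    subgoal using b2_le by blast
    subgoal using b2_ge by blast
    subgoal using b2_eq by blast
    subgoal using b2_conv by blast
    subgoal using b3_ge by blast
    subgoal using b3_le by blast
    subgoal using b3_eq by blast
    subgoal using b3_conv by blast
    done
qed

end
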